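(* Let $\mathcal X$ be a proper geodesic metric space that can be equipped with a maximal almost HHS structure. Then for each Morse gauge $N$ there exists a constant $C$ such that for any $(a,b,c,d)\in\partial\mathcal X^{(4,N)}$ at least one of $[a,b,c,d]_N$, $[a,c,b,d]_N$, or $[b,a,c,d]_N$ is less than $C$.
   Context: **Quasi-geodesics, Morse.** A $(\lambda,\varepsilon)$-quasi-geodesic in a metric space ($\lambda\ge1,\varepsilon\ge0$) is a map $\gamma$ from a closed interval $I\subseteq\mathbb R$ with $\frac1\lambda|s-t|-\varepsilon\le d(\gamma(s),\gamma(t))\le\lambda|s-t|+\varepsilon$. A Morse gauge is a function $N:[1,\infty)\times[0,\infty)\to[0,\infty)$; a quasi-geodesic $\gamma$ is $N$-Morse if every $(\lambda,\varepsilon)$-quasi-geodesic with endpoints on $\gamma$ lies in the $N(\lambda,\varepsilon)$-neighborhood of $\gamma$. Convention: when a geodesic is said to be $N$-Morse, $N$ is assumed large enough that all its subgeodesics are also $N$-Morse. **Morse boundary (as a set).** For a proper geodesic metric space $X$ with basepoint $p$, $\partial X$ is the set of equivalence classes of geodesic rays based at $p$ that are $N$-Morse for some gauge $N$, two rays being equivalent (asymptotic) if their images have finite Hausdorff distance; changing $p$ gives canonically identified sets. A bi-infinite geodesic $\gamma$ is from $a$ to $b$ ($a,b\in\partial X$) if $\gamma|_{(-\infty,0]}$ is asymptotic to a representative of $a$ and $\gamma|_{[0,\infty)}$ to a representative of $b$. **Centers, cross-ratio.** $\partial X^{(n,N)}$ is the set of $n$-tuples of pairwise distinct points of $\partial X$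 such that every geodesic between any two of them is $N$-Morse. For $K>0$ and $(a,b,c)\in\partial X^{(3,N)}$, $m_X^{N,K}(a,b,c)$ is the set of $x\in X$ within $K$ of all three sides of some geodesic triangle with vertices $a,b,c$. For each gauge $N$, $K_N$ denotes a fixed constant such that every geodesic triangle in $X$ (with vertices in $X$ or $\partial X$) all of whose sides are $N$-Morse has points $q_1,q_2,q_3$, one on each side, pairwise at distance at most $K_N$ (such constants exist). The $N$-cross-ratio of $(a,b,c,d)\in\partial X^{(4,N)}$ is $[a,b,c,d]_N=\operatorname{diam}\big(m_X^{N,K_N}(a,b,c)\cup m_X^{N,K_N}(a,d,c)\big)$. **Almost HHS.** An almost hierarchically hyperbolic space structure on a geodesic metric space $(\mathcal X,d)$ consists of an index set $\mathfrak S$ and $\delta$-hyperbolic spaces $\{CW\}_{W\in\mathfrak S}$ (one $\delta$ for all; distances $d_W$; distances between sets are infima) such that, for some constants $\xi,\kappa_0\ge0$, $\lambda\ge1$, $E\ge\max\{\xi,\kappa_0\}$, $\alpha$, $n$, $M$, $K$: (1) Projections: maps $\pi_W:\mathcal X\to2^{CW}$ with non-empty values of diameter $\le\xi$, each $(K,K)$-coarsely Lipschitz, with $\pi_W(\mathcal X)$ $K$-quasiconvex. (2) Nesting: a partial order $\sqsubseteq$ on $\mathfrak S$ with a unique maximal element $S$; $\mathfrak S_W=\{V:V\sqsubseteq W\}$; for $V\sqsubsetneq W$ a specified $\rho^V_W\subseteq CW$ of diameter $\le\xi$ and a map $\rho^W_V:CW\to2^{CV}$. (3) Orthogonality: a symmetric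 anti-reflexive relation $\perp$; $V\sqsubseteq W$ and $W\perp U$ imply $V\perp U$; if $V\perp W$ then $V,W$ are not $\sqsubseteq$-comparable; sets of pairwise orthogonal elements have at most $M$ elements. (4) Transversality and consistency: $V,W$ are transverse ($V\pitchfork W$) if not orthogonal and not $\sqsubseteq$-comparable; then there are sets $\rho^V_W\subseteq CW$, $\rho^W_V\subseteq CV$ of diameter $\le\xi$ with $\min\{d_W(\pi_W(x),\rho^V_W),d_V(\pi_V(x),\rho^W_V)\}\le\kappa_0$ for all $x\in\mathcal X$. If $V\sqsubsetneq W$, then $\min\{d_W(\pi_W(x),\rho^V_W),\operatorname{diam}_{CV}(\pi_V(x)\cup\rho^W_V(\pi_W(x)))\}\le\kappa_0$ for all $x$. If $U\sqsubseteq V$, then $d_W(\rho^U_W,\rho^V_W)\le\kappa_0$ whenever $V\sqsubsetneq W$, or $V\pitchfork W$ and $W\not\perp U$. (5) Finite complexity: sets of pairwise $\sqsubseteq$-comparable elements have at most $n$ elements. (6) Large links: for $W\in\mathfrak S$, $x,x'\in\mathcal X$, with $P=\lambda d_W(\pi_W(x),\pi_W(x'))+\lambda$, there are $T_1,\dots,T_{\lfloor P\rfloor}\in\mathfrak S_W\setminus\{W\}$ such that every $T\in\mathfrak S_W\setminus\{W\}$ lies in some $\mathfrak S_{T_i}$ or satisfies $d_T(\pi_T(x),\pi_T(x'))<E$; and $d_W(\pi_W(x),\rho^{T_i}_W)\le P$ for each $i$. (7) Bounded geodesic image: for $V\sqsubsetneq W$ and every geodesic $\gamma$ of $CW$, $\operatorname{diam}_{CV}(\rho^W_V(\gamma))\le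 E$ or $\gamma$ meets the $E$-neighborhood of $\rho^V_W$. (8) Partial realization: for pairwise orthogonal $V_j$ and $p_j\in\pi_{V_j}(\mathcal X)$ there is $x\in\mathcal X$ with $d_{V_j}(\pi_{V_j}(x),p_j)\le\alpha$ for all $j$, and $d_V(\pi_V(x),\rho^{V_j}_V)\le\alpha$ whenever $V_j\sqsubsetneq V$ or $V\pitchfork V_j$. (9) Uniqueness: for each $\kappa\ge0$ there is $\theta(\kappa)$ such that $d(x,y)\ge\theta(\kappa)$ implies $d_V(\pi_V(x),\pi_V(y))\ge\kappa$ for some $V\in\mathfrak S$. **Maximal almost HHS.** An almost HHS $(\mathcal X,\mathfrak S)$ (with maximal element $S$) such that for every quasi-geodesic $\gamma$ in $\mathcal X$ the following are equivalent: (i) $\gamma$ is $N$-Morse for some gauge $N$; (ii) there is $B$ with $\operatorname{diam}_{CU}(\pi_U(\gamma))\le B$ for all $U\in\mathfrak S\setminus\{S\}$; (iii) $\pi_S\circ\gamma$ is an $(L,L)$-quasi-geodesic for some $L$; and moreover (for fixed quasi-geodesic constants of $\gamma$) $N$, $B$, $L$ determine each other. **Known fact used as background.** For almost HHSs the distance formula holds: for each sufficiently large $\sigma$ there are $A\ge1,B\ge0$ such that $\frac1A\Sigma-B\le d(x,y)\le A\Sigma+B$ for all $x,y\in\mathcal X$, where $\Sigma$ is the sum over $U\in\mathfrak S$ of those $d_U(\pi_U(x),\pi_U(y))$ that are at least $\sigma$. *)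

theory Defs
  imports "HOL-Analysis.Analysis"
begin

section \<open>Distances between sets\<close>

text \<open>
  All metric spaces are values of the library type of abstract metrics, so that the spaces of a
  hierarchically hyperbolic structure may be different carriers in one ambient type.
  Distances and diameters take values in \<^typ>\<open>ennreal\<close>: the infimum over an empty set is
  infinite, the supremum over an empty set is zero, and unbounded sets have infinite diameter.
\<close>

definition set_dist :: "'a metric \<Rightarrow> 'a set \<Rightarrow> 'a set \<Rightarrow> ennreal" where
  "set_dist X A B = (INF x\<in>A. INF y\<in>B. ennreal (mdist X x y))"

definition set_diam :: "'a metric \<Rightarrow> 'a set \<Rightarrow> ennreal" where
  "set_diam X A = (SUP x\<in>A. SUP y\<in>A. ennreal (mdist X x y))"

definition hausdorff_dist :: "'a metric \<Rightarrow> 'a set \<Rightarrow> 'a set \<Rightarrow> ennreal" where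
  "hausdorff_dist X A B = max (SUP x\<in>A. set_dist X {x} B) (SUP y\<in>B. set_dist X {y} A)"

text \<open>Neighborhoods are closed, as Morse gauges may take the value zero.\<close>

definition nbhd :: "'a metric \<Rightarrow> real \<Rightarrow> 'a set \<Rightarrow> 'a set" where
  "nbhd X r A = {x \<in> mspace X. set_dist X {x} A \<le> ennreal r}"

definition proper_metric :: "'a metric \<Rightarrow> bool" where
  "proper_metric X \<longleftrightarrow> (\<forall>x\<in>mspace X. \<forall>r. compactin (mtopology_of X) (mcball_of X x r))"


section \<open>Quasi-geodesics, geodesics and the Morse property\<close>

text \<open>A path is a function on the reals together with a parameter interval; its values outside
  the interval are irrelevant. Closed intervals may be unbounded or a single point.\<close>

definition closed_interval :: "real set \<Rightarrow> bool" where
  "closed_interval I \<longleftrightarrow> I \<noteq> {} \<and> closed I \<and> is_interval I"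

definition quasi_geodesic :: "'a metric \<Rightarrow> real \<Rightarrow> real \<Rightarrow> real set \<Rightarrow> (real \<Rightarrow> 'a) \<Rightarrow> bool" where
  "quasi_geodesic X L \<epsilon> I \<gamma> \<longleftrightarrow>
     1 \<le> L \<and> 0 \<le> \<epsilon> \<and> closed_interval I \<and> \<gamma> ` I \<subseteq> mspace X \<and>
     (\<forall>s\<in>I. \<forall>t\<in>I. \<bar>s - t\<bar> / L - \<epsilon> \<le> mdist X (\<gamma> s) (\<gamma> t) \<and>
                    mdist X (\<gamma> s) (\<gamma> t) \<le> L * \<bar>s - t\<bar> + \<epsilon>)"

text \<open>The same notion for set-valued maps, with infimal distances between the values.\<close>

definition coarse_quasi_geodesic ::
    "'a metric \<Rightarrow> real \<Rightarrow> real \<Rightarrow> real set \<Rightarrow> (real \<Rightarrow> 'a set) \<Rightarrow> bool" where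
  "coarse_quasi_geodesic X L \<epsilon> I F \<longleftrightarrow>
     1 \<le> L \<and> 0 \<le> \<epsilon> \<and> closed_interval I \<and> (\<forall>s\<in>I. F s \<noteq> {} \<and> F s \<subseteq> mspace X) \<and>
     (\<forall>s\<in>I. \<forall>t\<in>I. ennreal (\<bar>s - t\<bar> / L - \<epsilon>) \<le> set_dist X (F s) (F t) \<and>
                    set_dist X (F s) (F t) \<le> ennreal (L * \<bar>s - t\<bar> + \<epsilon>))"

definition geodesic :: "'a metric \<Rightarrow> real set \<Rightarrow> (real \<Rightarrow> 'a) \<Rightarrow> bool" where
  "geodesic X I \<gamma> \<longleftrightarrow>
     closed_interval I \<and> \<gamma> ` I \<subseteq> mspace X \<and> (\<forall>s\<in>I. \<forall>t\<in>I. mdist X (\<gamma> s) (\<gamma> t) = \<bar>s - t\<bar>)"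

definition morse_gauge :: "(real \<Rightarrow> real \<Rightarrow> real) \<Rightarrow> bool" where
  "morse_gauge N \<longleftrightarrow> (\<forall>L\<ge>1. \<forall>\<epsilon>\<ge>0. 0 \<le> N L \<epsilon>)"

definition morse :: "'a metric \<Rightarrow> (real \<Rightarrow> real \<Rightarrow> real) \<Rightarrow> real set \<Rightarrow> (real \<Rightarrow> 'a) \<Rightarrow> bool" where
  "morse X N I \<gamma> \<longleftrightarrow>
     (\<forall>L \<epsilon> s t q. s \<le> t \<longrightarrow> quasi_geodesic X L \<epsilon> {s..t} q \<longrightarrow> q s \<in> \<gamma> ` I \<longrightarrow> q t \<in> \<gamma> ` I \<longrightarrow>
        q ` {s..t} \<subseteq> nbhd X (N L \<epsilon>) (\<gamma> ` I))"

text \<open>By convention, a geodesic is called \<open>N\<close>-Morse only if all its subgeodesics are.\<close>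

definition morse_geodesic ::
    "'a metric \<Rightarrow> (real \<Rightarrow> real \<Rightarrow> real) \<Rightarrow> real set \<Rightarrow> (real \<Rightarrow> 'a) \<Rightarrow> bool" where
  "morse_geodesic X N I \<gamma> \<longleftrightarrow>
     geodesic X I \<gamma> \<and> (\<forall>J. closed_interval J \<longrightarrow> J \<subseteq> I \<longrightarrow> morse X N J \<gamma>)"


section \<open>The Morse boundary\<close>

definition asymptotic :: "'a metric \<Rightarrow> 'a set \<Rightarrow> 'a set \<Rightarrow> bool" where
  "asymptotic X A B \<longleftrightarrow> hausdorff_dist X A B < \<infinity>"

definition morse_rays :: "'a metric \<Rightarrow> 'a \<Rightarrow> (real \<Rightarrow> 'a) set" where
  "morse_rays X p = {\<gamma>. \<gamma> 0 = p \<and> (\<exists>N. morse_gauge N \<and> morse_geodesic X N {0..} \<gamma>)}"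

definition morse_boundary :: "'a metric \<Rightarrow> 'a \<Rightarrow> (real \<Rightarrow> 'a) set set" where
  "morse_boundary X p =
     morse_rays X p //
       {(\<alpha>, \<beta>). \<alpha> \<in> morse_rays X p \<and> \<beta> \<in> morse_rays X p \<and> asymptotic X (\<alpha> ` {0..}) (\<beta> ` {0..})}"

definition converges_to :: "'a metric \<Rightarrow> 'a set \<Rightarrow> (real \<Rightarrow> 'a) set \<Rightarrow> bool" where
  "converges_to X A a \<longleftrightarrow> (\<exists>\<alpha>\<in>a. asymptotic X A (\<alpha> ` {0..}))"


section \<open>Geodesic triangles and hyperbolicity\<close>

datatype 'a vertex = Point 'a | Ideal "(real \<Rightarrow> 'a) set"

fun geodesic_joining ::
    "'a metric \<Rightarrow> 'a vertex \<Rightarrow> 'a vertex \<Rightarrow> real set \<Rightarrow> (real \<Rightarrow> 'a) \<Rightarrow> bool" where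
  "geodesic_joining X (Point x) (Point y) I \<gamma> \<longleftrightarrow>
     geodesic X I \<gamma> \<and> (\<exists>t\<ge>0. I = {0..t} \<and> \<gamma> 0 = x \<and> \<gamma> t = y)"
| "geodesic_joining X (Point x) (Ideal b) I \<gamma> \<longleftrightarrow>
     geodesic X I \<gamma> \<and> I = {0..} \<and> \<gamma> 0 = x \<and> converges_to X (\<gamma> ` {0..}) b"
| "geodesic_joining X (Ideal a) (Point y) I \<gamma> \<longleftrightarrow>
     geodesic X I \<gamma> \<and> I = {..0} \<and> \<gamma> 0 = y \<and> converges_to X (\<gamma> ` {..0}) a"
| "geodesic_joining X (Ideal a) (Ideal b) I \<gamma> \<longleftrightarrow>
     geodesic X I \<gamma> \<and> I = UNIV \<and> converges_to X (\<gamma> ` {..0}) a \<and> converges_to X (\<gamma> ` {0..}) b"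

definition geodesic_triangle ::
    "'a metric \<Rightarrow> 'a vertex \<Rightarrow> 'a vertex \<Rightarrow> 'a vertex \<Rightarrow> real set \<Rightarrow> (real \<Rightarrow> 'a) \<Rightarrow>
     real set \<Rightarrow> (real \<Rightarrow> 'a) \<Rightarrow> real set \<Rightarrow> (real \<Rightarrow> 'a) \<Rightarrow> bool" where
  "geodesic_triangle X u v w I\<^sub>1 \<gamma>\<^sub>1 I\<^sub>2 \<gamma>\<^sub>2 I\<^sub>3 \<gamma>\<^sub>3 \<longleftrightarrow>
     geodesic_joining X u v I\<^sub>1 \<gamma>\<^sub>1 \<and> geodesic_joining X v w I\<^sub>2 \<gamma>\<^sub>2 \<and> geodesic_joining X w u I\<^sub>3 \<gamma>\<^sub>3"

definition geodesic_space :: "'a metric \<Rightarrow> bool" where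
  "geodesic_space X \<longleftrightarrow>
     (\<forall>x\<in>mspace X. \<forall>y\<in>mspace X. \<exists>I \<gamma>. geodesic_joining X (Point x) (Point y) I \<gamma>)"

text \<open>Rips condition; it suffices to state it for one side, because cyclic permutations of a
  triangle are triangles.\<close>

definition hyperbolic_space :: "real \<Rightarrow> 'a metric \<Rightarrow> bool" where
  "hyperbolic_space \<delta> X \<longleftrightarrow> geodesic_space X \<and>
     (\<forall>x y z I\<^sub>1 \<gamma>\<^sub>1 I\<^sub>2 \<gamma>\<^sub>2 I\<^sub>3 \<gamma>\<^sub>3.
        geodesic_triangle X (Point x) (Point y) (Point z) I\<^sub>1 \<gamma>\<^sub>1 I\<^sub>2 \<gamma>\<^sub>2 I\<^sub>3 \<gamma>\<^sub>3 \<longrightarrow>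
        \<gamma>\<^sub>1 ` I\<^sub>1 \<subseteq> nbhd X \<delta> (\<gamma>\<^sub>2 ` I\<^sub>2 \<union> \<gamma>\<^sub>3 ` I\<^sub>3))"

definition quasiconvex :: "'a metric \<Rightarrow> real \<Rightarrow> 'a set \<Rightarrow> bool" where
  "quasiconvex X K A \<longleftrightarrow>
     (\<forall>x\<in>A. \<forall>y\<in>A. \<forall>I \<gamma>. geodesic_joining X (Point x) (Point y) I \<gamma> \<longrightarrow> \<gamma> ` I \<subseteq> nbhd X K A)"


section \<open>Centers and the cross-ratio\<close>

definition boundary_tuples ::
    "'a metric \<Rightarrow> 'a \<Rightarrow> nat \<Rightarrow> (real \<Rightarrow> real \<Rightarrow> real) \<Rightarrow> (real \<Rightarrow> 'a) set list set" where
  "boundary_tuples X p n N =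
     {as. length as = n \<and> distinct as \<and> set as \<subseteq> morse_boundary X p \<and>
          (\<forall>a\<in>set as. \<forall>b\<in>set as. a \<noteq> b \<longrightarrow>
             (\<forall>I \<gamma>. geodesic_joining X (Ideal a) (Ideal b) I \<gamma> \<longrightarrow> morse_geodesic X N I \<gamma>))}"

text \<open>The gauge only restricts the triples \<open>a, b, c\<close> for which this set is considered, so it
  is not an argument here.\<close>

definition centers ::
    "'a metric \<Rightarrow> real \<Rightarrow> (real \<Rightarrow> 'a) set \<Rightarrow> (real \<Rightarrow> 'a) set \<Rightarrow> (real \<Rightarrow> 'a) set \<Rightarrow> 'a set" where
  "centers X K a b c =
     {x. \<exists>I\<^sub>1 \<gamma>\<^sub>1 I\<^sub>2 \<gamma>\<^sub>2 I\<^sub>3 \<gamma>\<^sub>3.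
           geodesic_triangle X (Ideal a) (Ideal b) (Ideal c) I\<^sub>1 \<gamma>\<^sub>1 I\<^sub>2 \<gamma>\<^sub>2 I\<^sub>3 \<gamma>\<^sub>3 \<and>
           x \<in> nbhd X K (\<gamma>\<^sub>1 ` I\<^sub>1) \<and> x \<in> nbhd X K (\<gamma>\<^sub>2 ` I\<^sub>2) \<and> x \<in> nbhd X K (\<gamma>\<^sub>3 ` I\<^sub>3)}"

fun is_vertex :: "'a metric \<Rightarrow> 'a \<Rightarrow> 'a vertex \<Rightarrow> bool" where
  "is_vertex X p (Point x) \<longleftrightarrow> x \<in> mspace X"
| "is_vertex X p (Ideal a) \<longleftrightarrow> a \<in> morse_boundary X p"

text \<open>The defining property of the constant \<open>K\<^sub>N\<close>.\<close>

definition center_constant :: "'a metric \<Rightarrow> 'a \<Rightarrow> (real \<Rightarrow> real \<Rightarrow> real) \<Rightarrow> real \<Rightarrow> bool" where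
  "center_constant X p N k \<longleftrightarrow> 0 < k \<and>
     (\<forall>u v w I\<^sub>1 \<gamma>\<^sub>1 I\<^sub>2 \<gamma>\<^sub>2 I\<^sub>3 \<gamma>\<^sub>3.
        is_vertex X p u \<longrightarrow> is_vertex X p v \<longrightarrow> is_vertex X p w \<longrightarrow>
        geodesic_triangle X u v w I\<^sub>1 \<gamma>\<^sub>1 I\<^sub>2 \<gamma>\<^sub>2 I\<^sub>3 \<gamma>\<^sub>3 \<longrightarrow>
        morse_geodesic X N I\<^sub>1 \<gamma>\<^sub>1 \<longrightarrow> morse_geodesic X N I\<^sub>2 \<gamma>\<^sub>2 \<longrightarrow> morse_geodesic X N I\<^sub>3 \<gamma>\<^sub>3 \<longrightarrow>
        (\<exists>q\<^sub>1\<in>\<gamma>\<^sub>1 ` I\<^sub>1. \<exists>q\<^sub>2\<in>\<gamma>\<^sub>2 ` I\<^sub>2. \<exists>q\<^sub>3\<in>\<gamma>\<^sub>3 ` I\<^sub>3.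
           mdist X q\<^sub>1 q\<^sub>2 \<le> k \<and> mdist X q\<^sub>2 q\<^sub>3 \<le> k \<and> mdist X q\<^sub>1 q\<^sub>3 \<le> k))"

text \<open>To be applied with \<open>k = K\<^sub>N\<close>.\<close>

definition cross_ratio ::
    "'a metric \<Rightarrow> real \<Rightarrow> (real \<Rightarrow> 'a) set \<Rightarrow> (real \<Rightarrow> 'a) set \<Rightarrow> (real \<Rightarrow> 'a) set \<Rightarrow>
     (real \<Rightarrow> 'a) set \<Rightarrow> ennreal" where
  "cross_ratio X k a b c d = set_diam X (centers X k a b c \<union> centers X k a d c)"


section \<open>Almost hierarchically hyperbolic spaces\<close>

text \<open>
  \<open>\<rho> V W\<close> is the subset \<open>\<rho>\<^sup>V\<^sub>W\<close> of \<open>C W\<close>, for \<open>V\<close> properly nested in or transverse to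
  \<open>W\<close>; \<open>\<rho>\<^sub>m W V\<close> is the map \<open>\<rho>\<^sup>W\<^sub>V\<close> from \<open>C W\<close> to subsets of \<open>C V\<close>, for \<open>V\<close> properly
  nested in \<open>W\<close>. Values of the data outside these cases are irrelevant.
\<close>

locale hhs_data =
  fixes X :: "'a metric"
    and \<SS> :: "'i set"
    and C :: "'i \<Rightarrow> 'c metric"
    and \<pi> :: "'i \<Rightarrow> 'a \<Rightarrow> 'c set"
    and nest :: "'i \<Rightarrow> 'i \<Rightarrow> bool"  (infix "\<sqsubseteq>" 50)
    and orth :: "'i \<Rightarrow> 'i \<Rightarrow> bool"  (infix "\<bottom>" 50)
    and \<rho> :: "'i \<Rightarrow> 'i \<Rightarrow> 'c set"
    and \<rho>\<^sub>m :: "'i \<Rightarrow> 'i \<Rightarrow> 'c \<Rightarrow> 'c set"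
    and S :: 'i
begin

abbreviation set_dist_in :: "'i \<Rightarrow> 'c set \<Rightarrow> 'c set \<Rightarrow> ennreal"  ("d") where
  "d W \<equiv> set_dist (C W)"

abbreviation set_diam_in :: "'i \<Rightarrow> 'c set \<Rightarrow> ennreal"  ("diam") where
  "diam W \<equiv> set_diam (C W)"

definition proj :: "'i \<Rightarrow> 'a set \<Rightarrow> 'c set" where
  "proj W A = (\<Union>x\<in>A. \<pi> W x)"

definition comparable :: "'i \<Rightarrow> 'i \<Rightarrow> bool" where
  "comparable V W \<longleftrightarrow> V \<sqsubseteq> W \<or> W \<sqsubseteq> V"

definition proper_nest :: "'i \<Rightarrow> 'i \<Rightarrow> bool"  (infix "\<sqsubset>" 50) where
  "V \<sqsubset> W \<longleftrightarrow> V \<sqsubseteq> W \<and> V \<noteq> W"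

definition transverse :: "'i \<Rightarrow> 'i \<Rightarrow> bool"  (infix "\<pitchfork>" 50) where
  "V \<pitchfork> W \<longleftrightarrow> \<not> V \<bottom> W \<and> \<not> comparable V W"

end

text \<open>
  In the large links axiom the domains \<open>T\<^sub>1, \<dots>, T\<^bsub>\<lfloor>P\<rfloor>\<^esub>\<close> form a set of at most \<open>\<lfloor>P\<rfloor>\<close>
  elements. They cannot be required to be exactly \<open>\<lfloor>P\<rfloor> \<ge> 1\<close> many, since there are none when
  \<open>W\<close> is nesting-minimal.
\<close>

locale almost_hhs = hhs_data X \<SS> C \<pi> nest orth \<rho> \<rho>\<^sub>m S
  for X :: "'a metric"
    and \<SS> :: "'i set"
    and C :: "'i \<Rightarrow> 'c metric"
    and \<pi> :: "'i \<Rightarrow> 'a \<Rightarrow> 'c set"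
    and nest :: "'i \<Rightarrow> 'i \<Rightarrow> bool"  (infix "\<sqsubseteq>" 50)
    and orth :: "'i \<Rightarrow> 'i \<Rightarrow> bool"  (infix "\<bottom>" 50)
    and \<rho> :: "'i \<Rightarrow> 'i \<Rightarrow> 'c set"
    and \<rho>\<^sub>m :: "'i \<Rightarrow> 'i \<Rightarrow> 'c \<Rightarrow> 'c set"
    and S :: 'i +
  fixes \<delta> \<xi> \<kappa>\<^sub>0 L E \<alpha> K :: real
    and n M :: nat
  assumes geodesic_X: "geodesic_space X"
    and hyperbolic: "W \<in> \<SS> \<Longrightarrow> hyperbolic_space \<delta> (C W)"
    and constants: "0 \<le> \<delta>" "0 \<le> \<xi>" "0 \<le> \<kappa>\<^sub>0" "1 \<le> L" "max \<xi> \<kappa>\<^sub>0 \<le> E" "0 \<le> \<alpha>" "0 \<le> K"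
    and proj_values: "W \<in> \<SS> \<Longrightarrow> x \<in> mspace X \<Longrightarrow>
          \<pi> W x \<noteq> {} \<and> \<pi> W x \<subseteq> mspace (C W) \<and> diam W (\<pi> W x) \<le> ennreal \<xi>"
    and proj_lipschitz: "W \<in> \<SS> \<Longrightarrow> x \<in> mspace X \<Longrightarrow> y \<in> mspace X \<Longrightarrow>
          d W (\<pi> W x) (\<pi> W y) \<le> ennreal (K * mdist X x y + K)"
    and proj_quasiconvex: "W \<in> \<SS> \<Longrightarrow> quasiconvex (C W) K (proj W (mspace X))"
    and nest_order: "partial_order_on \<SS> {(V, W). V \<in> \<SS> \<and> W \<in> \<SS> \<and> V \<sqsubseteq> W}"
    and unique_maximal: "S \<in> \<SS>" "W \<in> \<SS> \<Longrightarrow> (\<forall>V\<in>\<SS>. W \<sqsubseteq> V \<longrightarrow> V = W) \<longleftrightarrow> W = S"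
    and nest_rho: "V \<in> \<SS> \<Longrightarrow> W \<in> \<SS> \<Longrightarrow> V \<sqsubset> W \<Longrightarrow>
          \<rho> V W \<subseteq> mspace (C W) \<and> diam W (\<rho> V W) \<le> ennreal \<xi>"
    and nest_rho_map: "V \<in> \<SS> \<Longrightarrow> W \<in> \<SS> \<Longrightarrow> V \<sqsubset> W \<Longrightarrow> z \<in> mspace (C W) \<Longrightarrow>
          \<rho>\<^sub>m W V z \<subseteq> mspace (C V)"
    and orth_sym: "V \<in> \<SS> \<Longrightarrow> W \<in> \<SS> \<Longrightarrow> V \<bottom> W \<Longrightarrow> W \<bottom> V"
    and orth_irrefl: "V \<in> \<SS> \<Longrightarrow> \<not> V \<bottom> V"
    and orth_nest: "U \<in> \<SS> \<Longrightarrow> V \<in> \<SS> \<Longrightarrow> W \<in> \<SS> \<Longrightarrow> V \<sqsubseteq> W \<Longrightarrow> W \<bottom> U \<Longrightarrow> V \<bottom> U"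
    and orth_not_comparable: "V \<in> \<SS> \<Longrightarrow> W \<in> \<SS> \<Longrightarrow> V \<bottom> W \<Longrightarrow> \<not> comparable V W"
    and orth_bound: "A \<subseteq> \<SS> \<Longrightarrow> pairwise orth A \<Longrightarrow> finite A \<and> card A \<le> M"
    and transverse_rho: "V \<in> \<SS> \<Longrightarrow> W \<in> \<SS> \<Longrightarrow> V \<pitchfork> W \<Longrightarrow>
          \<rho> V W \<subseteq> mspace (C W) \<and> diam W (\<rho> V W) \<le> ennreal \<xi>"
    and transverse_consistency: "V \<in> \<SS> \<Longrightarrow> W \<in> \<SS> \<Longrightarrow> V \<pitchfork> W \<Longrightarrow> x \<in> mspace X \<Longrightarrow>
          min (d W (\<pi> W x) (\<rho> V W)) (d V (\<pi> V x) (\<rho> W V)) \<le> ennreal \<kappa>\<^sub>0"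
    and nest_consistency: "V \<in> \<SS> \<Longrightarrow> W \<in> \<SS> \<Longrightarrow> V \<sqsubset> W \<Longrightarrow> x \<in> mspace X \<Longrightarrow>
          min (d W (\<pi> W x) (\<rho> V W)) (diam V (\<pi> V x \<union> (\<Union>z\<in>\<pi> W x. \<rho>\<^sub>m W V z))) \<le> ennreal \<kappa>\<^sub>0"
    and rho_consistency: "U \<in> \<SS> \<Longrightarrow> V \<in> \<SS> \<Longrightarrow> W \<in> \<SS> \<Longrightarrow> U \<sqsubseteq> V \<Longrightarrow>
          V \<sqsubset> W \<or> (V \<pitchfork> W \<and> \<not> W \<bottom> U) \<Longrightarrow> d W (\<rho> U W) (\<rho> V W) \<le> ennreal \<kappa>\<^sub>0"
    and finite_complexity: "A \<subseteq> \<SS> \<Longrightarrow> pairwise comparable A \<Longrightarrow> finite A \<and> card A \<le> n"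
    and large_links: "W \<in> \<SS> \<Longrightarrow> x \<in> mspace X \<Longrightarrow> x' \<in> mspace X \<Longrightarrow>
          P = L * enn2real (d W (\<pi> W x) (\<pi> W x')) + L \<Longrightarrow>
          \<exists>\<T>. finite \<T> \<and> card \<T> \<le> nat \<lfloor>P\<rfloor> \<and>
              (\<forall>T\<in>\<T>. T \<in> \<SS> \<and> T \<sqsubset> W \<and> d W (\<pi> W x) (\<rho> T W) \<le> ennreal P) \<and>
              (\<forall>T\<in>\<SS>. T \<sqsubset> W \<longrightarrow>
                 (\<exists>T'\<in>\<T>. T \<sqsubseteq> T') \<or> d T (\<pi> T x) (\<pi> T x') < ennreal E)"
    and bounded_geodesic_image: "V \<in> \<SS> \<Longrightarrow> W \<in> \<SS> \<Longrightarrow> V \<sqsubset> W \<Longrightarrow> geodesic (C W) I \<gamma> \<Longrightarrow>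
          diam V (\<Union>t\<in>I. \<rho>\<^sub>m W V (\<gamma> t)) \<le> ennreal E \<or> \<gamma> ` I \<inter> nbhd (C W) E (\<rho> V W) \<noteq> {}"
    and partial_realization: "A \<subseteq> \<SS> \<Longrightarrow> pairwise orth A \<Longrightarrow>
          (\<forall>V\<in>A. q V \<in> proj V (mspace X)) \<Longrightarrow>
          \<exists>x\<in>mspace X. \<forall>V\<in>A. d V (\<pi> V x) {q V} \<le> ennreal \<alpha> \<and>
            (\<forall>W\<in>\<SS>. V \<sqsubset> W \<or> V \<pitchfork> W \<longrightarrow> d W (\<pi> W x) (\<rho> V W) \<le> ennreal \<alpha>)"
    and uniqueness: "0 \<le> \<kappa> \<Longrightarrow>
          \<exists>\<theta>::real. \<forall>x\<in>mspace X. \<forall>y\<in>mspace X. \<theta> \<le> mdist X x y \<longrightarrow>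
            (\<exists>V\<in>\<SS>. ennreal \<kappa> \<le> d V (\<pi> V x) (\<pi> V y))"


section \<open>Maximal almost hierarchically hyperbolic spaces\<close>

text \<open>\<open>P c I \<gamma>\<close> and \<open>Q c' I \<gamma>\<close> are properties of a quasi-geodesic with parameters. They are
  interdetermined if each implies the other for all \<open>(L, \<epsilon>)\<close>-quasi-geodesics, with the parameter
  obtained depending only on \<open>L\<close>, \<open>\<epsilon>\<close> and the parameter given (and not on the quasi-geodesic).
  In particular the existence of a parameter for \<open>P\<close> and for \<open>Q\<close> are then equivalent.\<close>

definition determines ::
    "'a metric \<Rightarrow> ('p \<Rightarrow> real set \<Rightarrow> (real \<Rightarrow> 'a) \<Rightarrow> bool) \<Rightarrow>
     ('q \<Rightarrow> real set \<Rightarrow> (real \<Rightarrow> 'a) \<Rightarrow> bool) \<Rightarrow> bool" where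
  "determines X P Q \<longleftrightarrow>
     (\<forall>L \<epsilon> c. \<exists>c'. \<forall>I \<gamma>. quasi_geodesic X L \<epsilon> I \<gamma> \<longrightarrow> P c I \<gamma> \<longrightarrow> Q c' I \<gamma>)"

definition interdetermined ::
    "'a metric \<Rightarrow> ('p \<Rightarrow> real set \<Rightarrow> (real \<Rightarrow> 'a) \<Rightarrow> bool) \<Rightarrow>
     ('q \<Rightarrow> real set \<Rightarrow> (real \<Rightarrow> 'a) \<Rightarrow> bool) \<Rightarrow> bool" where
  "interdetermined X P Q \<longleftrightarrow> determines X P Q \<and> determines X Q P"

context hhs_data
begin

definition morse_with :: "(real \<Rightarrow> real \<Rightarrow> real) \<Rightarrow> real set \<Rightarrow> (real \<Rightarrow> 'a) \<Rightarrow> bool" where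
  "morse_with N I \<gamma> \<longleftrightarrow> morse_gauge N \<and> morse X N I \<gamma>"

definition bounded_projections :: "real \<Rightarrow> real set \<Rightarrow> (real \<Rightarrow> 'a) \<Rightarrow> bool" where
  "bounded_projections B I \<gamma> \<longleftrightarrow> (\<forall>U\<in>\<SS> - {S}. diam U (proj U (\<gamma> ` I)) \<le> ennreal B)"

definition top_quasi_geodesic :: "real \<Rightarrow> real set \<Rightarrow> (real \<Rightarrow> 'a) \<Rightarrow> bool" where
  "top_quasi_geodesic L I \<gamma> \<longleftrightarrow> coarse_quasi_geodesic (C S) L L I (\<pi> S \<circ> \<gamma>)"

definition maximal_almost_hhs :: bool where
  "maximal_almost_hhs \<longleftrightarrow>
     (\<exists>\<delta> \<xi> \<kappa>\<^sub>0 L E \<alpha> K n M. almost_hhs X \<SS> C \<pi> nest orth \<rho> \<rho>\<^sub>m S \<delta> \<xi> \<kappa>\<^sub>0 L E \<alpha> K n M) \<and>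
     interdetermined X morse_with bounded_projections \<and>
     interdetermined X morse_with top_quasi_geodesic \<and>
     interdetermined X bounded_projections top_quasi_geodesic"

end

end

theory Submission
  imports Defs
begin

text \<open>
  Four boundary points joined by \<open>N\<close>-Morse geodesics behave as in a hyperbolic space. Two asymptotic
  \<open>N\<close>-Morse rays with nearby starting points stay uniformly close, so the geodesic triangles on these
  points are uniformly slim tripods around the points given by the center constant, and all coarse
  centers of a triple lie uniformly close together. By slimness a center of \<open>a, b, c\<close> is close to two
  of the geodesics that join these points to \<open>d\<close>, hence it is also a coarse center of one of the other
  three triples. If two of the points are not joined by any geodesic, then the triples containing them
  have no centers, and a cross-ratio comparing such a triple with another one is bounded trivially.
\<close>

section \<open>Nearness with real radii and asymptotic sets\<close>

text \<open>An actual point of \<open>A\<close> witnesses the bound, whereas \<open>nbhd\<close>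
  only bounds an infimum. This lets the triangle inequality be used in the reals; coming from
  \<open>nbhd\<close> costs an arbitrarily small increase of the radius, taken to be 1
  later.\<close>

definition near_set :: "'a metric \<Rightarrow> real \<Rightarrow> 'a set \<Rightarrow> 'a \<Rightarrow> bool" where
  "near_set X r A x \<longleftrightarrow> (\<exists>y\<in>A. mdist X x y \<le> r)"

text \<open>One half of having finite Hausdorff distance. It is kept separate because attraction to
  a Morse ray uses a single direction.\<close>

definition coarsely_in :: "'a metric \<Rightarrow> 'a set \<Rightarrow> 'a set \<Rightarrow> bool" where
  "coarsely_in X A B \<longleftrightarrow> (\<exists>r. \<forall>x\<in>A. near_set X r B x)"

lemma near_set_mono: "near_set X r A x \<Longrightarrow> r \<le> s \<Longrightarrow> A \<subseteq> B \<Longrightarrow> near_set X s B x"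
  unfolding near_set_def by force

lemma near_set_refl: "x \<in> A \<Longrightarrow> A \<subseteq> mspace X \<Longrightarrow> 0 \<le> r \<Longrightarrow> near_set X r A x"
  unfolding near_set_def by (metis mdist_zero subsetD)

lemma near_set_trans:
  assumes "near_set X r A x" "\<And>y. y \<in> A \<Longrightarrow> near_set X s B y"
    "x \<in> mspace X" "A \<subseteq> mspace X" "B \<subseteq> mspace X"
  shows "near_set X (r + s) B x"
proof -
  obtain y where y: "y \<in> A" "mdist X x y \<le> r" using assms(1) unfolding near_set_def by blast
  obtain z where z: "z \<in> B" "mdist X y z \<le> s" using assms(2)[OF y(1)] unfolding near_set_def by blast
  have "mdist X x z \<le> mdist X x y + mdist X y z" using assms y z by (intro mdist_triangle) auto
  thus ?thesis unfolding near_set_def using y z by force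
qed

lemma near_set_Un: "near_set X r (A \<union> B) x \<longleftrightarrow> near_set X r A x \<or> near_set X r B x"
  unfolding near_set_def by blast

lemma set_dist_point_le: "near_set X r A x \<Longrightarrow> set_dist X {x} A \<le> ennreal r"
  unfolding set_dist_def near_set_def by (auto intro: INF_lower2 ennreal_leI)

lemma near_set_of_set_dist_less:
  assumes "set_dist X {x} A < ennreal r" "0 < r"
  shows "near_set X r A x"
proof -
  have "(INF y\<in>A. ennreal (mdist X x y)) < ennreal r"
    using assms(1) unfolding set_dist_def by simp
  then obtain y where "y \<in> A" "ennreal (mdist X x y) < ennreal r" by (auto simp: INF_less_iff)
  thus ?thesis unfolding near_set_def using ennreal_less_iff[of "mdist X x y" r]
    by (intro bexI[of _ y]) auto
qed

lemma near_set_of_nbhd: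
  assumes "x \<in> nbhd X r A" "0 \<le> r" "r < s"
  shows "near_set X s A x"
proof (rule near_set_of_set_dist_less)
  have "set_dist X {x} A \<le> ennreal r" using assms(1) unfolding nbhd_def by simp
  also have "\<dots> < ennreal s" using assms by (simp add: ennreal_less_iff)
  finally show "set_dist X {x} A < ennreal s" .
qed (use assms in simp)

text \<open>The Hausdorff distance is the maximum of two suprema, and such a supremum is finite
  exactly when one radius serves all points. Raising the radius by 1 turns the infimal distances
  into witnesses.\<close>

lemma asymptotic_iff_coarsely_in:
  "asymptotic X A B \<longleftrightarrow> coarsely_in X A B \<and> coarsely_in X B A"
proof -
  have half: "(SUP x\<in>A. set_dist X {x} B) < \<infinity> \<longleftrightarrow> coarsely_in X A B" for A B
  proof
    assume "(SUP x\<in>A. set_dist X {x} B) < \<infinity>"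
    then obtain r where r: "0 \<le> r" "(SUP x\<in>A. set_dist X {x} B) = ennreal r"
      by (cases "SUP x\<in>A. set_dist X {x} B") auto
    have "near_set X (r + 1) B x" if "x \<in> A" for x
    proof (rule near_set_of_set_dist_less)
      have "set_dist X {x} B \<le> ennreal r"
        unfolding r(2)[symmetric] using that by (rule SUP_upper)
      also have "\<dots> < ennreal (r + 1)" using r(1) by (simp add: ennreal_less_iff)
      finally show "set_dist X {x} B < ennreal (r + 1)" .
    qed (use r in simp)
    thus "coarsely_in X A B" unfolding coarsely_in_def by blast
  next
    assume "coarsely_in X A B"
    then obtain r where "\<forall>x\<in>A. near_set X r B x" unfolding coarsely_in_def by blast
    hence "(SUP x\<in>A. set_dist X {x} B) \<le> ennreal r"
      by (intro SUP_least set_dist_point_le) auto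
    thus "(SUP x\<in>A. set_dist X {x} B) < \<infinity>" using le_less_trans by fastforce
  qed
  show ?thesis unfolding asymptotic_def hausdorff_dist_def
    unfolding max_less_iff_conj by (simp only: half)
qed

lemma coarsely_in_trans:
  assumes "coarsely_in X A B" "coarsely_in X B C"
    and "A \<subseteq> mspace X" "B \<subseteq> mspace X" "C \<subseteq> mspace X"
  shows "coarsely_in X A C"
proof -
  obtain r s where "\<forall>x\<in>A. near_set X r B x" "\<forall>x\<in>B. near_set X s C x"
    using assms(1,2) unfolding coarsely_in_def by blast
  hence "\<forall>x\<in>A. near_set X (r + s) C x"
    using assms(3-) by (intro ballI near_set_trans[of X r B]) auto
  thus ?thesis unfolding coarsely_in_def by blast
qed

lemma asymptotic_sym: "asymptotic X A B \<Longrightarrow> asymptotic X B A"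
  by (simp add: asymptotic_iff_coarsely_in)

lemma asymptotic_trans:
  assumes "asymptotic X A B" "asymptotic X B C"
    and "A \<subseteq> mspace X" "B \<subseteq> mspace X" "C \<subseteq> mspace X"
  shows "asymptotic X A C"
  using assms coarsely_in_trans unfolding asymptotic_iff_coarsely_in by blast

section \<open>Geodesics and affine reparametrization\<close>

lemma geodesic_in: "geodesic X I \<gamma> \<Longrightarrow> t \<in> I \<Longrightarrow> \<gamma> t \<in> mspace X"
  unfolding geodesic_def by blast

lemma geodesic_dist: "geodesic X I \<gamma> \<Longrightarrow> s \<in> I \<Longrightarrow> t \<in> I \<Longrightarrow> mdist X (\<gamma> s) (\<gamma> t) = \<bar>s - t\<bar>"
  unfolding geodesic_def by blast

lemma closed_interval_Icc: "s \<le> t \<Longrightarrow> closed_interval {s..t}"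
  unfolding closed_interval_def by (auto simp: is_interval_cc)

lemma closed_interval_half_lines [simp]: "closed_interval {t..}" "closed_interval {..t}"
    "closed_interval UNIV"
  unfolding closed_interval_def by (auto simp: is_interval_convex_1)

lemma closed_interval_affine:
  fixes e t :: real
  assumes "closed_interval I" "e \<noteq> 0"
  shows "closed_interval ((\<lambda>u. t + e * u) ` I)"
proof -
  have "closed ((\<lambda>x. t + x) ` ((\<lambda>x. e *\<^sub>R x) ` I))"
    using assms unfolding closed_interval_def by (intro closed_translation closed_scaling) auto
  hence "closed ((\<lambda>u. t + e * u) ` I)" by (simp add: image_image)
  moreover have "convex ((\<lambda>u. t + e *\<^sub>R u) ` I)"
    using assms unfolding closed_interval_def is_interval_convex_1 by (intro convex_affinity) auto
  ultimately show ?thesis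
    using assms unfolding closed_interval_def by (auto simp: is_interval_convex_1)
qed

text \<open>Being Morse depends only on the image of a path.\<close>

lemma morse_geodesic_reparam:
  assumes "morse_geodesic X N I \<gamma>" "\<bar>e\<bar> = 1" "closed_interval J" "(\<lambda>u. t + e * u) ` J \<subseteq> I"
  shows "morse_geodesic X N J (\<lambda>u. \<gamma> (t + e * u))"
proof -
  have g: "geodesic X I \<gamma>" using assms(1) unfolding morse_geodesic_def by blast
  have "geodesic X J (\<lambda>u. \<gamma> (t + e * u))"
    unfolding geodesic_def
  proof (intro conjI ballI)
    show "(\<lambda>u. \<gamma> (t + e * u)) ` J \<subseteq> mspace X" using assms(4) geodesic_in[OF g] by auto
    fix u v assume "u \<in> J" "v \<in> J"
    hence "mdist X (\<gamma> (t + e * u)) (\<gamma> (t + e * v)) = \<bar>e * u - e * v\<bar>"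
      using geodesic_dist[OF g] assms(4) by (simp add: image_subset_iff)
    also have "\<dots> = \<bar>e\<bar> * \<bar>u - v\<bar>" by (simp add: abs_mult[symmetric] right_diff_distrib)
    finally show "mdist X (\<gamma> (t + e * u)) (\<gamma> (t + e * v)) = \<bar>u - v\<bar>" using assms(2) by simp
  qed fact
  moreover have "morse X N J' (\<lambda>u. \<gamma> (t + e * u))" if "closed_interval J'" "J' \<subseteq> J" for J'
  proof -
    have "morse X N ((\<lambda>u. t + e * u) ` J') \<gamma>"
      using assms(1) closed_interval_affine[OF that(1), of e t] assms(2,4) that(2)
      unfolding morse_geodesic_def by fastforce
    thus ?thesis unfolding morse_def by (simp add: image_image)
  qed
  ultimately show ?thesis unfolding morse_geodesic_def by blast
qed

section \<open>Quasi-geodesic surgery and attraction to Morse rays\<close>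

text \<open>Both points of a pair move by at most \<open>k\<close>, which affects only the additive
  constant. Since quasi-geodesics need not be continuous, a path can thus be made to start on
  another ray by a jump.\<close>

lemma quasi_geodesic_perturb:
  assumes "quasi_geodesic X L \<epsilon> I q" "0 \<le> k"
    and "\<And>t. t \<in> I \<Longrightarrow> q' t \<in> mspace X" "\<And>t. t \<in> I \<Longrightarrow> mdist X (q t) (q' t) \<le> k"
  shows "quasi_geodesic X L (\<epsilon> + 2 * k) I q'"
  unfolding quasi_geodesic_def
proof (intro conjI ballI)
  fix s t assume I: "s \<in> I" "t \<in> I"
  have m: "q s \<in> mspace X" "q t \<in> mspace X" "q' s \<in> mspace X" "q' t \<in> mspace X"
    using assms(1,3) I unfolding quasi_geodesic_def by auto
  have q: "\<bar>s - t\<bar> / L - \<epsilon> \<le> mdist X (q s) (q t)" "mdist X (q s) (q t) \<le> L * \<bar>s - t\<bar> + \<epsilon>"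
    using assms(1) I unfolding quasi_geodesic_def by auto
  have "mdist X (q s) (q t) \<le> mdist X (q s) (q' s) + (mdist X (q' s) (q' t) + mdist X (q' t) (q t))"
    using m mdist_triangle[of "q s" X "q' s" "q t"] mdist_triangle[of "q' s" X "q' t" "q t"] by linarith
  moreover have "mdist X (q' s) (q' t)
      \<le> mdist X (q' s) (q s) + (mdist X (q s) (q t) + mdist X (q t) (q' t))"
    using m mdist_triangle[of "q' s" X "q s" "q' t"] mdist_triangle[of "q s" X "q t" "q' t"] by linarith
  ultimately show "\<bar>s - t\<bar> / L - (\<epsilon> + 2 * k) \<le> mdist X (q' s) (q' t)"
      "mdist X (q' s) (q' t) \<le> L * \<bar>s - t\<bar> + (\<epsilon> + 2 * k)"
    using q assms(4)[OF I(1)] assms(4)[OF I(2)]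
    by (auto simp: mdist_commute[of X "q' s" "q s"] mdist_commute[of X "q' t" "q t"])
qed (use assms in \<open>auto simp: quasi_geodesic_def\<close>)

text \<open>For \<open>u\<close> on \<open>\<beta>\<close> and \<open>v\<close> on \<open>\<eta>\<close> at distances \<open>m\<close> and \<open>r\<close> from the corner, \<open>d(u, v)\<close> is at least
  \<open>m - r\<close>, and at least \<open>r - 1\<close> because the corner is almost nearest to the endpoint of \<open>\<eta>\<close>.\<close>

lemma quasi_geodesic_concat_nearest:
  assumes \<beta>: "geodesic X {0..} \<beta>" and \<eta>: "geodesic X {0..l} \<eta>" and "0 \<le> T" "0 \<le> l"
    and corner: "\<eta> 0 = \<beta> T"
    and near: "\<And>s. 0 \<le> s \<Longrightarrow> mdist X (\<eta> l) (\<beta> T) \<le> mdist X (\<eta> l) (\<beta> s) + 1"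
  shows "quasi_geodesic X 3 1 {0..T + l} (\<lambda>u. if u < T then \<beta> u else \<eta> (u - T))"
    (is "quasi_geodesic X 3 1 ?I ?q")
proof -
  have m: "?q u \<in> mspace X" if "u \<in> ?I" for u
    using that geodesic_in[OF \<beta>] geodesic_in[OF \<eta>] assms(3,4) by auto
  have *: "\<bar>s - t\<bar> / 3 - 1 \<le> mdist X (?q s) (?q t) \<and> mdist X (?q s) (?q t) \<le> 3 * \<bar>s - t\<bar> + 1"
    if "s \<le> t" "s \<in> ?I" "t \<in> ?I" for s t
  proof -
    consider "t < T" | "T \<le> s" | "s < T" "T \<le> t" by linarith
    thus ?thesis
    proof cases
      case 1
      thus ?thesis using that geodesic_dist[OF \<beta>, of s t] by (auto simp: field_simps)
    next
      case 2
      hence "mdist X (?q s) (?q t) = \<bar>s - t\<bar>"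
        using that geodesic_dist[OF \<eta>, of "s - T" "t - T"] by auto
      thus ?thesis using that(1) by (auto simp: field_simps)
    next
      case 3
      let ?u = "\<beta> s" and ?v = "\<eta> (t - T)"
      have mem: "?u \<in> mspace X" "?v \<in> mspace X" "\<beta> T \<in> mspace X" "\<eta> l \<in> mspace X"
        using that 3 assms(3,4) geodesic_in[OF \<beta>] geodesic_in[OF \<eta>] by auto
      have d: "mdist X ?u (\<beta> T) = T - s" "mdist X (\<beta> T) ?v = t - T"
        "mdist X (\<eta> l) (\<beta> T) = l" "mdist X (\<eta> l) ?v = l - (t - T)"
        using that 3 assms(3,4) geodesic_dist[OF \<beta>, of s T] geodesic_dist[OF \<eta>, of 0 "t - T"]
          geodesic_dist[OF \<eta>, of l 0] geodesic_dist[OF \<eta>, of l "t - T"]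
        unfolding corner[symmetric] by auto
      have "mdist X ?u ?v \<le> (T - s) + (t - T)"
        using mdist_triangle[of ?u X "\<beta> T" ?v] mem d by simp
      moreover have "T - s \<le> mdist X ?u ?v + (t - T)"
        using mdist_triangle[of ?u X ?v "\<beta> T"] mem d by (simp add: mdist_commute)
      moreover have "mdist X (\<eta> l) ?u \<le> l - (t - T) + mdist X ?u ?v"
        using mdist_triangle[of "\<eta> l" X ?v ?u] mem d by (simp add: mdist_commute)
      moreover have "l \<le> mdist X (\<eta> l) ?u + 1" using near[of s] that d by auto
      moreover have "\<bar>s - t\<bar> = t - s" using that by simp
      moreover have "?q s = ?u" "?q t = ?v" using 3 by auto
      \<comment> \<open>With \<open>m = T - s\<close> and \<open>r = t - T\<close>, adding the lower
        bound \<open>m - r\<close> to twice the lower bound \<open>r - 1\<close> shows that three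
        times the distance is at least \<open>m + r - 2\<close>, where \<open>m + r\<close> is the
        parameter distance. Hence the factor 3.\<close>
      ultimately show ?thesis using that(1) by (simp only:) (simp add: field_simps)
    qed
  qed
  show ?thesis unfolding quasi_geodesic_def
  proof (intro conjI ballI)
    fix s t assume "s \<in> ?I" "t \<in> ?I"
    hence "\<bar>s - t\<bar> / 3 - 1 \<le> mdist X (?q s) (?q t) \<and> mdist X (?q s) (?q t) \<le> 3 * \<bar>s - t\<bar> + 1"
      using *[of s t] *[of t s] by (metis abs_minus_commute linear mdist_commute)
    thus "\<bar>s - t\<bar> / 3 - 1 \<le> mdist X (?q s) (?q t)" "mdist X (?q s) (?q t) \<le> 3 * \<bar>s - t\<bar> + 1"
      by auto
  next
    show "?q ` ?I \<subseteq> mspace X" using m by (rule image_subsetI)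
  qed (use assms(3,4) closed_interval_Icc in auto)
qed

text \<open>Distances are bounded below by 0, so their infimum exists, and the slack 1 leaves room
  for it not to be attained.\<close>

lemma exists_almost_nearest:
  assumes "I \<noteq> {}"
  shows "\<exists>t\<in>I. \<forall>s\<in>I. mdist X x (f t) \<le> mdist X x (f s) + 1"
proof -
  have bdd: "bdd_below ((\<lambda>s. mdist X x (f s)) ` I)" by (rule bdd_belowI[of _ 0]) auto
  obtain t where "t \<in> I" "mdist X x (f t) < (INF s\<in>I. mdist X x (f s)) + 1"
    using assms by (metis cINF_less_iff[OF assms bdd] less_add_one)
  moreover have "(INF s\<in>I. mdist X x (f s)) \<le> mdist X x (f s)" if "s \<in> I" for s
    using bdd that by (rule cINF_lower)
  ultimately show ?thesis by (intro bexI[of _ t]) (auto, smt (verit))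
qed

text \<open>The path that jumps from \<open>\<alpha> 0\<close> to \<open>\<beta> 0\<close>, runs along \<open>\<beta>\<close> up to a point almost nearest to a far
  point \<open>\<alpha> T\<close>, and then along a geodesic to \<open>\<alpha> T\<close>, is a \<open>(3, 2k + 1)\<close>-quasi-geodesic, whatever the
  finite Hausdorff distance of the rays is.\<close>

lemma morse_ray_attracts:
  assumes geod: "geodesic_space X" and N: "0 \<le> N 3 (2 * k + 1)"
    and \<alpha>: "geodesic X {0..} \<alpha>" and mor: "morse X N {0..} \<alpha>" and \<beta>: "geodesic X {0..} \<beta>"
    and k: "mdist X (\<alpha> 0) (\<beta> 0) \<le> k"
    and coarse: "coarsely_in X (\<alpha> ` {0..}) (\<beta> ` {0..})" and x: "x \<in> \<beta> ` {0..}"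
  shows "near_set X (k + N 3 (2 * k + 1) + 1) (\<alpha> ` {0..}) x"
proof -
  have k0: "0 \<le> k" using k mdist_nonneg[of X "\<alpha> 0" "\<beta> 0"] by linarith
  obtain t where t: "0 \<le> t" "x = \<beta> t" using x by auto
  obtain D where D: "\<forall>x\<in>\<alpha> ` {0..}. near_set X D (\<beta> ` {0..}) x"
    using coarse unfolding coarsely_in_def by blast
  show ?thesis
  proof (cases "t = 0")
    \<comment> \<open>The path constructed in the other case replaces \<open>\<beta> 0\<close> by
      \<open>\<alpha> 0\<close>, so this point is treated directly.\<close>
    case True
    have "mdist X x (\<alpha> 0) \<le> k + N 3 (2 * k + 1) + 1"
      using True t k N by (simp add: mdist_commute)
    thus ?thesis unfolding near_set_def by force
  next
    case False
    \<comment> \<open>The triangle inequality below gives \<open>T \<le> k + T' + D + 1\<close>, so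
      this choice forces \<open>t < T'\<close> and the path really passes through \<open>x\<close>.
      The absolute value makes \<open>T\<close> a parameter of the ray whatever the sign of
      \<open>D\<close>.\<close>
    define T where "T = \<bar>t + k + D + 2\<bar>"
    have T0: "0 \<le> T" unfolding T_def by simp
    obtain T' where T': "T' \<in> {0..}" "\<forall>s\<in>{0..}. mdist X (\<alpha> T) (\<beta> T') \<le> mdist X (\<alpha> T) (\<beta> s) + 1"
      using exists_almost_nearest[of "{0::real..}" X "\<alpha> T" \<beta>] by auto
    obtain s0 where s0: "0 \<le> s0" "mdist X (\<alpha> T) (\<beta> s0) \<le> D"
      using D T0 unfolding near_set_def by auto
    have mem: "\<alpha> T \<in> mspace X" "\<beta> T' \<in> mspace X" "\<alpha> 0 \<in> mspace X" "\<beta> 0 \<in> mspace X"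
      using geodesic_in[OF \<alpha>] geodesic_in[OF \<beta>] T0 T' by auto
    have "mdist X (\<alpha> 0) (\<alpha> T) \<le> mdist X (\<alpha> 0) (\<beta> 0) + mdist X (\<beta> 0) (\<beta> T') + mdist X (\<beta> T') (\<alpha> T)"
      using mdist_triangle[of "\<alpha> 0" X "\<beta> 0" "\<alpha> T"] mdist_triangle[of "\<beta> 0" X "\<beta> T'" "\<alpha> T"] mem
      by linarith
    moreover have "mdist X (\<alpha> 0) (\<alpha> T) = T" "mdist X (\<beta> 0) (\<beta> T') = T'"
      using geodesic_dist[OF \<alpha>, of 0 T] geodesic_dist[OF \<beta>, of 0 T'] T0 T' by auto
    moreover have "mdist X (\<beta> T') (\<alpha> T) \<le> D + 1"
      using T'(2) s0 by (subst mdist_commute) force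
    ultimately have tT: "t < T'" using k T_def by linarith
    obtain I \<eta> where "geodesic_joining X (Point (\<beta> T')) (Point (\<alpha> T)) I \<eta>"
      using geod mem unfolding geodesic_space_def by blast
    then obtain l where \<eta>: "geodesic X {0..l} \<eta>" "0 \<le> l" "\<eta> 0 = \<beta> T'" "\<eta> l = \<alpha> T" by auto
    define q where "q u = (if u < T' then \<beta> u else \<eta> (u - T'))" for u
    define q' where "q' u = (if u = 0 then \<alpha> 0 else q u)" for u
    have "quasi_geodesic X 3 1 {0..T' + l} q"
      unfolding q_def using T' \<eta> by (intro quasi_geodesic_concat_nearest[OF \<beta> \<eta>(1)]) auto
    hence "quasi_geodesic X 3 (1 + 2 * k) {0..T' + l} q'"
    proof (rule quasi_geodesic_perturb)
      fix u assume u: "u \<in> {0..T' + l}"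
      have qm: "q u \<in> mspace X"
        unfolding q_def using u geodesic_in[OF \<beta>] geodesic_in[OF \<eta>(1)] by auto
      thus "q' u \<in> mspace X" unfolding q'_def using mem by simp
      show "mdist X (q u) (q' u) \<le> k"
      proof (cases "u = 0")
        case True
        have "q 0 = \<beta> 0" unfolding q_def using t tT by simp
        thus ?thesis using True k unfolding q'_def by (simp add: mdist_commute)
      next
        case False
        thus ?thesis using mdist_zero[OF qm qm] k0 unfolding q'_def by simp
      qed
    qed (rule k0)
    moreover have "q' 0 \<in> \<alpha> ` {0..}" "q' (T' + l) \<in> \<alpha> ` {0..}" "0 \<le> T' + l"
      unfolding q'_def q_def using T' \<eta> T0 tT t by auto
    ultimately have "q' ` {0..T' + l} \<subseteq> nbhd X (N 3 (2 * k + 1)) (\<alpha> ` {0..})"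
      using mor unfolding morse_def by (simp add: add.commute)
    moreover have "x = q' t" "t \<in> {0..T' + l}"
      unfolding q'_def q_def using tT t False \<eta> by auto
    ultimately have "x \<in> nbhd X (N 3 (2 * k + 1)) (\<alpha> ` {0..})" by blast
    hence "near_set X (N 3 (2 * k + 1) + 1) (\<alpha> ` {0..}) x"
      by (rule near_set_of_nbhd) (use N in auto)
    thus ?thesis by (rule near_set_mono) (use k0 in auto)
  qed
qed

section \<open>Rays converging to a boundary point\<close>

lemma morse_boundary_class_asymptotic:
  assumes "a \<in> morse_boundary X p" "\<alpha> \<in> a" "\<beta> \<in> a"
  shows "asymptotic X (\<alpha> ` {0..}) (\<beta> ` {0..})" "\<alpha> ` {0..} \<subseteq> mspace X"
proof -
  obtain \<gamma> where \<gamma>: "\<gamma> \<in> morse_rays X p"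
    "a = {(\<alpha>, \<beta>). \<alpha> \<in> morse_rays X p \<and> \<beta> \<in> morse_rays X p \<and>
           asymptotic X (\<alpha> ` {0..}) (\<beta> ` {0..})} `` {\<gamma>}"
    using assms(1) unfolding morse_boundary_def by (rule quotientE)
  have im: "\<delta> ` {0..} \<subseteq> mspace X" if "\<delta> \<in> morse_rays X p" for \<delta>
    using that geodesic_in unfolding morse_rays_def morse_geodesic_def by blast
  have "asymptotic X (\<gamma> ` {0..}) (\<alpha> ` {0..})" "asymptotic X (\<gamma> ` {0..}) (\<beta> ` {0..})"
    "\<alpha> \<in> morse_rays X p" "\<beta> \<in> morse_rays X p"
    using assms(2,3) \<gamma>(2) by auto
  thus "asymptotic X (\<alpha> ` {0..}) (\<beta> ` {0..})" "\<alpha> ` {0..} \<subseteq> mspace X"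
    using \<gamma>(1) im by (meson asymptotic_sym asymptotic_trans)+
qed

lemma converges_to_asymptotic:
  assumes "a \<in> morse_boundary X p" "converges_to X A a" "converges_to X B a"
    and "A \<subseteq> mspace X" "B \<subseteq> mspace X"
  shows "asymptotic X A B"
proof -
  obtain \<alpha> \<beta> where "\<alpha> \<in> a" "\<beta> \<in> a" "asymptotic X A (\<alpha> ` {0..})" "asymptotic X B (\<beta> ` {0..})"
    using assms(2,3) unfolding converges_to_def by blast
  thus ?thesis
    using morse_boundary_class_asymptotic[OF assms(1)] assms(4,5)
    by (meson asymptotic_sym asymptotic_trans)
qed

lemma converges_to_cong:
  assumes "a \<in> morse_boundary X p" "converges_to X A a" "asymptotic X B A"
    and "A \<subseteq> mspace X" "B \<subseteq> mspace X"
  shows "converges_to X B a"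
  using assms morse_boundary_class_asymptotic[OF assms(1)] unfolding converges_to_def
  by (meson asymptotic_trans)

text \<open>Clamping the parameter into the other half-line moves a point by at most the distance
  between the two cut parameters.\<close>

lemma asymptotic_subrays:
  assumes "geodesic X UNIV \<gamma>"
  shows "asymptotic X (\<gamma> ` {s..}) (\<gamma> ` {t..})" "asymptotic X (\<gamma> ` {..s}) (\<gamma> ` {..t})"
proof -
  have "near_set X \<bar>s - t\<bar> (\<gamma> ` {t..}) (\<gamma> u)" if "u \<in> {s..}" for s t u
    unfolding near_set_def using that geodesic_dist[OF assms, of u "max u t"]
    by (intro bexI[of _ "\<gamma> (max u t)"]) auto
  thus "asymptotic X (\<gamma> ` {s..}) (\<gamma> ` {t..})"
    unfolding asymptotic_iff_coarsely_in coarsely_in_def by blast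
  have "near_set X \<bar>s - t\<bar> (\<gamma> ` {..t}) (\<gamma> u)" if "u \<in> {..s}" for s t u
    unfolding near_set_def using that geodesic_dist[OF assms, of u "min u t"]
    by (intro bexI[of _ "\<gamma> (min u t)"]) auto
  thus "asymptotic X (\<gamma> ` {..s}) (\<gamma> ` {..t})"
    unfolding asymptotic_iff_coarsely_in coarsely_in_def by blast
qed

section \<open>Morse lines and their end rays for a fixed gauge\<close>

locale morse_triangles =
  fixes X :: "'a metric" and p :: 'a and N :: "real \<Rightarrow> real \<Rightarrow> real" and k :: real
  assumes geod: "geodesic_space X" and gauge: "morse_gauge N" and center: "center_constant X p N k"
begin

abbreviation boundary :: "(real \<Rightarrow> 'a) set set"  ("\<partial>") where
  "\<partial> \<equiv> morse_boundary X p"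

text \<open>An image rather than a parametrized path, so that orientation disappears and
  \<open>line_sym\<close> holds for the same set.\<close>

definition line :: "(real \<Rightarrow> 'a) set \<Rightarrow> (real \<Rightarrow> 'a) set \<Rightarrow> 'a set \<Rightarrow> bool" where
  "line a b \<Gamma> \<longleftrightarrow> a \<in> \<partial> \<and> b \<in> \<partial> \<and>
     (\<exists>\<gamma>. geodesic_joining X (Ideal a) (Ideal b) UNIV \<gamma> \<and> morse_geodesic X N UNIV \<gamma> \<and> \<Gamma> = range \<gamma>)"

text \<open>Unlike in \<open>morse_rays\<close> the starting point is free, because these rays arise
  by cutting lines at arbitrary points.\<close>

definition end_ray :: "(real \<Rightarrow> 'a) set \<Rightarrow> (real \<Rightarrow> 'a) \<Rightarrow> bool" where
  "end_ray a \<rho> \<longleftrightarrow> a \<in> \<partial> \<and> morse_geodesic X N {0..} \<rho> \<and> converges_to X (\<rho> ` {0..}) a"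

text \<open>The radius from \<open>morse_ray_attracts\<close>. It is built from \<open>N\<close> and
  \<open>k\<close> alone, which makes the final bound uniform over all boundary tuples.\<close>

definition D :: real where
  "D = k + N 3 (2 * k + 1) + 1"

lemma k_pos: "0 < k"
  using center unfolding center_constant_def by blast

lemma N_nonneg: "0 \<le> N 3 (2 * k + 1)"
  using gauge k_pos unfolding morse_gauge_def by auto

lemma D_pos: "0 < D"
  using k_pos N_nonneg unfolding D_def by linarith

lemma geodesic_joining_reverse:
  assumes "geodesic_joining X (Ideal a) (Ideal b) UNIV \<gamma>"
  shows "geodesic_joining X (Ideal b) (Ideal a) UNIV (\<lambda>u. \<gamma> (- u))"
proof -
  have "(\<lambda>u. \<gamma> (- u)) ` {..0} = \<gamma> ` {0..}" "(\<lambda>u. \<gamma> (- u)) ` {0..} = \<gamma> ` {..0}"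
    by (simp_all flip: image_image[of \<gamma> uminus])
  thus ?thesis using assms by (auto simp: geodesic_def)
qed

lemma line_sym: "line a b \<Gamma> \<Longrightarrow> line b a \<Gamma>"
proof -
  assume "line a b \<Gamma>"
  then obtain \<gamma> where \<gamma>: "a \<in> \<partial>" "b \<in> \<partial>" "geodesic_joining X (Ideal a) (Ideal b) UNIV \<gamma>"
      "morse_geodesic X N UNIV \<gamma>" "\<Gamma> = range \<gamma>"
    unfolding line_def by blast
  have "morse_geodesic X N UNIV (\<lambda>u. \<gamma> (- u))"
    using morse_geodesic_reparam[OF \<gamma>(4), of "-1" UNIV 0] by simp
  moreover have "range (\<lambda>u. \<gamma> (- u)) = range \<gamma>"
    by (simp flip: image_image[of \<gamma> uminus])
  ultimately show "line b a \<Gamma>"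
    unfolding line_def using \<gamma> geodesic_joining_reverse by blast
qed

lemma line_subset: "line a b \<Gamma> \<Longrightarrow> \<Gamma> \<subseteq> mspace X"
  unfolding line_def morse_geodesic_def geodesic_def by blast

lemma end_ray_subset: "end_ray a \<rho> \<Longrightarrow> \<rho> ` {0..} \<subseteq> mspace X"
  unfolding end_ray_def morse_geodesic_def geodesic_def by blast

text \<open>Moving the cut from parameter 0 to that of \<open>q\<close> changes each half by a
  bounded segment, so the ends stay the same. The distance formula records that the two rays
  together form a geodesic.\<close>

lemma line_split:
  assumes "line a b \<Gamma>" "q \<in> \<Gamma>"
  obtains \<rho> \<sigma> where "end_ray a \<rho>" "end_ray b \<sigma>" "\<rho> 0 = q" "\<sigma> 0 = q"
    "\<Gamma> = \<rho> ` {0..} \<union> \<sigma> ` {0..}"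
    "\<And>s t. 0 \<le> s \<Longrightarrow> 0 \<le> t \<Longrightarrow> mdist X (\<rho> s) (\<sigma> t) = s + t"
proof -
  obtain \<gamma> where \<gamma>: "a \<in> \<partial>" "b \<in> \<partial>" "geodesic_joining X (Ideal a) (Ideal b) UNIV \<gamma>"
      "morse_geodesic X N UNIV \<gamma>" "\<Gamma> = range \<gamma>"
    using assms(1) unfolding line_def by blast
  have g: "geodesic X UNIV \<gamma>" and conv: "converges_to X (\<gamma> ` {..0}) a" "converges_to X (\<gamma> ` {0..}) b"
    using \<gamma>(3) by auto
  obtain t0 where t0: "q = \<gamma> t0" using assms(2) \<gamma>(5) by auto
  \<comment> \<open>The factors -1 and 1 give both rays the shape expected by
    \<open>morse_geodesic_reparam\<close>.\<close>
  define \<rho> \<sigma> where \<rho>\<sigma>: "\<rho> = (\<lambda>u. \<gamma> (t0 + -1 * u))" "\<sigma> = (\<lambda>u. \<gamma> (t0 + 1 * u))"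
  have "(\<lambda>u. t0 + -1 * u) ` {0..} = {..t0}"
  proof (intro subset_antisym subsetI)
    fix x assume "x \<in> {..t0}" thus "x \<in> (\<lambda>u. t0 + -1 * u) ` {0..}"
      by (intro image_eqI[of _ _ "t0 - x"]) auto
  qed auto
  hence im1: "\<rho> ` {0..} = \<gamma> ` {..t0}" unfolding \<rho>\<sigma> by (metis image_image)
  have "(\<lambda>u. t0 + 1 * u) ` {0..} = {t0..}"
  proof (intro subset_antisym subsetI)
    fix x assume "x \<in> {t0..}" thus "x \<in> (\<lambda>u. t0 + 1 * u) ` {0..}"
      by (intro image_eqI[of _ _ "x - t0"]) auto
  qed auto
  hence im2: "\<sigma> ` {0..} = \<gamma> ` {t0..}" unfolding \<rho>\<sigma> by (metis image_image)
  have sub: "\<gamma> ` A \<subseteq> mspace X" for A using g unfolding geodesic_def by blast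
  show thesis
  proof
    show "end_ray a \<rho>" unfolding end_ray_def im1
      using \<gamma>(1) sub converges_to_cong[OF \<gamma>(1) conv(1) asymptotic_subrays(2)[OF g]]
        morse_geodesic_reparam[OF \<gamma>(4), of "-1" "{0..}" t0] unfolding \<rho>\<sigma> by auto
    show "end_ray b \<sigma>" unfolding end_ray_def im2
      using \<gamma>(2) sub converges_to_cong[OF \<gamma>(2) conv(2) asymptotic_subrays(1)[OF g]]
        morse_geodesic_reparam[OF \<gamma>(4), of 1 "{0..}" t0] unfolding \<rho>\<sigma> by auto
    show "\<rho> 0 = q" "\<sigma> 0 = q" unfolding \<rho>\<sigma> t0 by auto
    show "\<Gamma> = \<rho> ` {0..} \<union> \<sigma> ` {0..}"
      unfolding im1 im2 \<gamma>(5) image_Un[symmetric] by (rule arg_cong[of _ _ "image \<gamma>"]) auto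
    show "mdist X (\<rho> s) (\<sigma> t) = s + t" if "0 \<le> s" "0 \<le> t" for s t
      unfolding \<rho>\<sigma> using geodesic_dist[OF g, of "t0 + -1 * s" "t0 + 1 * t"] that by auto
  qed
qed

text \<open>A common end only gives some finite Hausdorff distance. The Morse property of
  \<open>\<rho>\<close> and nearby starting points turn this into the uniform radius
  \<open>D\<close>.\<close>

lemma end_rays_near:
  assumes "end_ray a \<rho>" "end_ray a \<sigma>" "mdist X (\<rho> 0) (\<sigma> 0) \<le> k" "x \<in> \<sigma> ` {0..}"
  shows "near_set X D (\<rho> ` {0..}) x"
proof -
  have "asymptotic X (\<rho> ` {0..}) (\<sigma> ` {0..})"
    using assms(1,2) end_ray_subset[OF assms(1)] end_ray_subset[OF assms(2)]
    by (intro converges_to_asymptotic[of a X p]) (auto simp: end_ray_def)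
  thus ?thesis unfolding D_def using assms N_nonneg
    by (intro morse_ray_attracts[OF geod, where \<beta> = \<sigma>])
       (auto simp: end_ray_def morse_geodesic_def asymptotic_iff_coarsely_in)
qed

text \<open>Apply the center constant to the degenerate triangle \<open>a, b, x\<close> with sides \<open>\<Gamma>\<close> and the two
  halves of \<open>\<Gamma>'\<close>.\<close>

lemma lines_near:
  assumes "line a b \<Gamma>" "line a b \<Gamma>'" "x \<in> \<Gamma>'"
  shows "near_set X (2 * k) \<Gamma> x"
proof -
  obtain \<gamma> where \<gamma>: "a \<in> \<partial>" "b \<in> \<partial>" "geodesic_joining X (Ideal a) (Ideal b) UNIV \<gamma>"
      "morse_geodesic X N UNIV \<gamma>" "\<Gamma> = range \<gamma>"
    using assms(1) unfolding line_def by blast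
  obtain \<rho> \<sigma> where split: "end_ray a \<rho>" "end_ray b \<sigma>" "\<rho> 0 = x" "\<sigma> 0 = x"
    "\<And>s t. 0 \<le> s \<Longrightarrow> 0 \<le> t \<Longrightarrow> mdist X (\<rho> s) (\<sigma> t) = s + t"
    using line_split[OF assms(2,3)] by metis
  have x: "x \<in> mspace X" using assms line_subset by blast
  \<comment> \<open>A side from an ideal vertex to a point is parametrized by the negative
    half-line, so \<open>\<sigma>\<close> has to be reversed.\<close>
  have "(\<lambda>u. \<sigma> (- u)) ` {..0} = \<sigma> ` {0..}"
    by (simp flip: image_image[of \<sigma> uminus])
  moreover have \<sigma>: "morse_geodesic X N {..0} (\<lambda>u. \<sigma> (- u))"
    using split(2) morse_geodesic_reparam[of X N "{0..}" \<sigma> "-1" "{..0}" 0]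
    unfolding end_ray_def by auto
  ultimately have tri: "geodesic_triangle X (Ideal a) (Ideal b) (Point x)
      UNIV \<gamma> {..0} (\<lambda>u. \<sigma> (- u)) {0..} \<rho>"
    using \<gamma> split unfolding geodesic_triangle_def end_ray_def morse_geodesic_def by auto
  obtain q1 q2 q3 where q: "q1 \<in> range \<gamma>" "q2 \<in> (\<lambda>u. \<sigma> (- u)) ` {..0}" "q3 \<in> \<rho> ` {0..}"
    "mdist X q1 q2 \<le> k" "mdist X q2 q3 \<le> k" "mdist X q1 q3 \<le> k"
    using center tri \<gamma> x \<sigma> split(1) unfolding center_constant_def end_ray_def
    by (metis is_vertex.simps)
  obtain u where u: "u \<le> 0" "q2 = \<sigma> (- u)" using q(2) by auto
  obtain s where s: "0 \<le> s" "q3 = \<rho> s" using q(3) by auto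
  \<comment> \<open>The points \<open>q2\<close> and \<open>q3\<close> lie on opposite halves of
    \<open>\<Gamma>'\<close>, so \<open>x\<close> is between them and no farther from
    \<open>q3\<close> than \<open>q2\<close> is.\<close>
  have "mdist X q3 q2 = s + (- u)" using split(5)[of s "- u"] u s by simp
  moreover have "mdist X q3 x = s" using split(5)[of s 0] split(4) s by simp
  ultimately have "mdist X x q3 \<le> k" using q u by (simp add: mdist_commute)
  moreover have "q1 \<in> mspace X" "q3 \<in> mspace X"
    using q \<gamma>(5) line_subset[OF assms(1)] end_ray_subset[OF split(1)] by auto
  ultimately have "mdist X x q1 \<le> 2 * k"
    using mdist_triangle[of x X q3 q1] x q(6) by (simp add: mdist_commute)
  thus ?thesis unfolding near_set_def using q \<gamma> by blast
qed

lemma near_lines: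
  assumes "near_set X r \<Gamma>' x" "x \<in> mspace X" "line a b \<Gamma>" "line a b \<Gamma>'"
  shows "near_set X (r + 2 * k) \<Gamma> x"
  using assms by (intro near_set_trans[of X r \<Gamma>']) (auto intro: lines_near dest: line_subset)

text \<open>The witnesses at parameters \<open>s\<close> and \<open>t\<close> are at distance
  \<open>s + t\<close>, and this is at most \<open>2 * r\<close> through \<open>x\<close>. So
  \<open>q\<close> is within \<open>2 * r\<close> of the first witness and within
  \<open>3 * r\<close> of \<open>x\<close>.\<close>

lemma near_both_halves:
  assumes "end_ray a \<rho>" "end_ray b \<sigma>" "\<rho> 0 = q"
    and "\<And>s t. 0 \<le> s \<Longrightarrow> 0 \<le> t \<Longrightarrow> mdist X (\<rho> s) (\<sigma> t) = s + t"
    and "near_set X r (\<rho> ` {0..}) x" "near_set X r (\<sigma> ` {0..}) x" "x \<in> mspace X"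
  shows "mdist X x q \<le> 3 * r"
proof -
  obtain s where s: "0 \<le> s" "mdist X x (\<rho> s) \<le> r" using assms(5) unfolding near_set_def by auto
  obtain t where t: "0 \<le> t" "mdist X x (\<sigma> t) \<le> r" using assms(6) unfolding near_set_def by auto
  have m: "\<rho> s \<in> mspace X" "\<sigma> t \<in> mspace X" "q \<in> mspace X"
    using end_ray_subset assms(1-3) s t by blast+
  have "mdist X (\<rho> s) q = s"
    using assms(1) geodesic_dist[of X "{0..}" \<rho> s 0] s unfolding assms(3)[symmetric]
    by (auto simp: end_ray_def morse_geodesic_def)
  moreover have "s + t \<le> r + r"
    using mdist_triangle[of "\<rho> s" X x "\<sigma> t"] m assms(7) s t assms(4)[OF s(1) t(1)]
    by (simp add: mdist_commute)
  ultimately show ?thesis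
    using mdist_triangle[of x X "\<rho> s" q] m assms(7) s t by simp
qed

section \<open>Tripods and slim triangles\<close>

text \<open>The center constant yields one point on each line, pairwise within \<open>k\<close>.
  Cutting there gives six rays; the two towards a common vertex stay within \<open>D\<close> of each
  other and form a leg. The last three properties say that distinct legs come close only near the
  corner \<open>q\<close>.\<close>

lemma triangle_legs:
  assumes ab: "line a b \<Gamma>\<^sub>1" and bc: "line b c \<Gamma>\<^sub>2" and ca: "line c a \<Gamma>\<^sub>3"
  obtains q A B C where
    "\<Gamma>\<^sub>1 \<subseteq> A \<union> B" "\<Gamma>\<^sub>2 \<subseteq> B \<union> C" "\<Gamma>\<^sub>3 \<subseteq> C \<union> A" "q \<in> mspace X"
    "A \<subseteq> mspace X" "B \<subseteq> mspace X" "C \<subseteq> mspace X"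
    "\<And>x. x \<in> A \<Longrightarrow> near_set X D \<Gamma>\<^sub>3 x \<and> near_set X D \<Gamma>\<^sub>1 x"
    "\<And>x. x \<in> B \<Longrightarrow> near_set X D \<Gamma>\<^sub>1 x \<and> near_set X D \<Gamma>\<^sub>2 x"
    "\<And>x. x \<in> C \<Longrightarrow> near_set X D \<Gamma>\<^sub>2 x \<and> near_set X D \<Gamma>\<^sub>3 x"
    "\<And>x r. x \<in> mspace X \<Longrightarrow> near_set X r A x \<Longrightarrow> near_set X r B x \<Longrightarrow> mdist X x q \<le> 3 * (r + D) + k"
    "\<And>x r. x \<in> mspace X \<Longrightarrow> near_set X r B x \<Longrightarrow> near_set X r C x \<Longrightarrow> mdist X x q \<le> 3 * (r + D) + k"
    "\<And>x r. x \<in> mspace X \<Longrightarrow> near_set X r C x \<Longrightarrow> near_set X r A x \<Longrightarrow> mdist X x q \<le> 3 * (r + D) + k"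
proof -
  obtain \<gamma>\<^sub>1 \<gamma>\<^sub>2 \<gamma>\<^sub>3 where
      "geodesic_triangle X (Ideal a) (Ideal b) (Ideal c) UNIV \<gamma>\<^sub>1 UNIV \<gamma>\<^sub>2 UNIV \<gamma>\<^sub>3"
      "morse_geodesic X N UNIV \<gamma>\<^sub>1" "morse_geodesic X N UNIV \<gamma>\<^sub>2" "morse_geodesic X N UNIV \<gamma>\<^sub>3"
      "\<Gamma>\<^sub>1 = range \<gamma>\<^sub>1" "\<Gamma>\<^sub>2 = range \<gamma>\<^sub>2" "\<Gamma>\<^sub>3 = range \<gamma>\<^sub>3" "a \<in> \<partial>" "b \<in> \<partial>" "c \<in> \<partial>"
    using assms unfolding line_def geodesic_triangle_def by metis
  then obtain q1 q2 q3 where q: "q1 \<in> \<Gamma>\<^sub>1" "q2 \<in> \<Gamma>\<^sub>2" "q3 \<in> \<Gamma>\<^sub>3"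
    "mdist X q1 q2 \<le> k" "mdist X q2 q3 \<le> k" "mdist X q1 q3 \<le> k"
    using center unfolding center_constant_def by (metis is_vertex.simps(2))
  obtain a1 b1 where r1: "end_ray a a1" "end_ray b b1" "a1 0 = q1" "b1 0 = q1"
    "\<Gamma>\<^sub>1 = a1 ` {0..} \<union> b1 ` {0..}" "\<And>s t. 0 \<le> s \<Longrightarrow> 0 \<le> t \<Longrightarrow> mdist X (a1 s) (b1 t) = s + t"
    using line_split[OF ab q(1)] by metis
  obtain b2 c2 where r2: "end_ray b b2" "end_ray c c2" "b2 0 = q2" "c2 0 = q2"
    "\<Gamma>\<^sub>2 = b2 ` {0..} \<union> c2 ` {0..}" "\<And>s t. 0 \<le> s \<Longrightarrow> 0 \<le> t \<Longrightarrow> mdist X (b2 s) (c2 t) = s + t"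
    using line_split[OF bc q(2)] by metis
  obtain c3 a3 where r3: "end_ray c c3" "end_ray a a3" "c3 0 = q3" "a3 0 = q3"
    "\<Gamma>\<^sub>3 = c3 ` {0..} \<union> a3 ` {0..}" "\<And>s t. 0 \<le> s \<Longrightarrow> 0 \<le> t \<Longrightarrow> mdist X (c3 s) (a3 t) = s + t"
    using line_split[OF ca q(3)] by metis
  have qm: "q1 \<in> mspace X" "q2 \<in> mspace X" "q3 \<in> mspace X"
    using q line_subset[OF ab] line_subset[OF bc] line_subset[OF ca] by auto
  have leg: "near_set X D (\<rho> ` {0..}) y \<and> near_set X D (\<sigma> ` {0..}) y"
    if "end_ray v \<rho>" "end_ray v \<sigma>" "mdist X (\<rho> 0) (\<sigma> 0) \<le> k" "y \<in> \<rho> ` {0..} \<union> \<sigma> ` {0..}"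
    for v \<rho> \<sigma> y
  proof -
    have "near_set X D (\<rho> ` {0..}) y" if "end_ray v \<rho>" "y \<in> \<rho> ` {0..}" for \<rho>
      using that end_ray_subset[OF that(1)] D_pos by (intro near_set_refl) auto
    thus ?thesis using that end_rays_near[of v \<rho> \<sigma> y] end_rays_near[of v \<sigma> \<rho> y]
      by (metis Un_iff mdist_commute)
  qed
  let ?A = "a1 ` {0..} \<union> a3 ` {0..}" and ?B = "b1 ` {0..} \<union> b2 ` {0..}"
    and ?C = "c2 ` {0..} \<union> c3 ` {0..}"
  note legA = leg[OF r1(1) r3(2)] and legB = leg[OF r1(2) r2(1)] and legC = leg[OF r2(2) r3(1)]
  have sub: "a1 ` {0..} \<subseteq> mspace X" "a3 ` {0..} \<subseteq> mspace X" "b1 ` {0..} \<subseteq> mspace X"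
      "b2 ` {0..} \<subseteq> mspace X" "c2 ` {0..} \<subseteq> mspace X" "c3 ` {0..} \<subseteq> mspace X"
    using end_ray_subset r1(1,2) r2(1,2) r3(1,2) by auto
  have d13: "mdist X (a1 0) (a3 0) \<le> k" "mdist X (b1 0) (b2 0) \<le> k" "mdist X (c2 0) (c3 0) \<le> k"
    using q r1 r2 r3 by auto
  show thesis
  proof (rule that[of ?A ?B ?C q1])
    show "near_set X D \<Gamma>\<^sub>3 x \<and> near_set X D \<Gamma>\<^sub>1 x" if "x \<in> ?A" for x
      using legA[OF d13(1) that] unfolding r1(5) r3(5) near_set_Un by blast
    show "near_set X D \<Gamma>\<^sub>1 x \<and> near_set X D \<Gamma>\<^sub>2 x" if "x \<in> ?B" for x
      using legB[OF d13(2) that] unfolding r1(5) r2(5) near_set_Un by blast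
    show "near_set X D \<Gamma>\<^sub>2 x \<and> near_set X D \<Gamma>\<^sub>3 x" if "x \<in> ?C" for x
      using legC[OF d13(3) that] unfolding r2(5) r3(5) near_set_Un by blast
    fix x r assume x: "x \<in> mspace X"
    \<comment> \<open>At cost \<open>D\<close>, nearness to a leg becomes nearness to either of its
      rays. Two legs can then be compared on the line that contains a ray of each, by
      \<open>near_both_halves\<close>.\<close>
    have A: "near_set X (r + D) (a1 ` {0..}) x" "near_set X (r + D) (a3 ` {0..}) x"
      if "near_set X r ?A x"
      using that x sub legA[OF d13(1)] by (auto intro!: near_set_trans[of X r ?A])
    have B: "near_set X (r + D) (b1 ` {0..}) x" "near_set X (r + D) (b2 ` {0..}) x"
      if "near_set X r ?B x"
      using that x sub legB[OF d13(2)] by (auto intro!: near_set_trans[of X r ?B])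
    have C: "near_set X (r + D) (c2 ` {0..}) x" "near_set X (r + D) (c3 ` {0..}) x"
      if "near_set X r ?C x"
      using that x sub legC[OF d13(3)] by (auto intro!: near_set_trans[of X r ?C])
    show "mdist X x q1 \<le> 3 * (r + D) + k" if "near_set X r ?A x" "near_set X r ?B x"
      using near_both_halves[OF r1(1-3,6) A(1)[OF that(1)] B(1)[OF that(2)] x] k_pos by simp
    show "mdist X x q1 \<le> 3 * (r + D) + k" if "near_set X r ?B x" "near_set X r ?C x"
      using near_both_halves[OF r2(1-3,6) B(2)[OF that(1)] C(1)[OF that(2)] x] q(4)
        mdist_triangle[OF x qm(2) qm(1)] by (simp add: mdist_commute)
    show "mdist X x q1 \<le> 3 * (r + D) + k" if "near_set X r ?C x" "near_set X r ?A x"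
      using near_both_halves[OF r3(1-3,6) C(2)[OF that(1)] A(2)[OF that(2)] x] q(6)
        mdist_triangle[OF x qm(3) qm(1)] by (simp add: mdist_commute)
  qed (use r1 r2 r3 qm sub in auto)
qed

text \<open>The line \<open>\<Gamma>\<^sub>1\<close> is covered by the legs towards \<open>a\<close>
  and \<open>b\<close>, which follow \<open>\<Gamma>\<^sub>3\<close> and
  \<open>\<Gamma>\<^sub>2\<close> respectively.\<close>

lemma triangle_slim:
  assumes "line a b \<Gamma>\<^sub>1" "line b c \<Gamma>\<^sub>2" "line c a \<Gamma>\<^sub>3" "near_set X r \<Gamma>\<^sub>1 x" "x \<in> mspace X"
  shows "near_set X (r + D) \<Gamma>\<^sub>2 x \<or> near_set X (r + D) \<Gamma>\<^sub>3 x"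
proof -
  obtain A B where AB: "\<Gamma>\<^sub>1 \<subseteq> A \<union> B" "A \<subseteq> mspace X" "B \<subseteq> mspace X"
      "\<And>x. x \<in> A \<Longrightarrow> near_set X D \<Gamma>\<^sub>3 x" "\<And>x. x \<in> B \<Longrightarrow> near_set X D \<Gamma>\<^sub>2 x"
    using triangle_legs[OF assms(1-3)] by metis
  have "near_set X r A x \<or> near_set X r B x"
    using assms(4) AB(1) unfolding near_set_Un[symmetric] by (auto intro: near_set_mono)
  thus ?thesis
    using AB assms line_subset[OF assms(2)] line_subset[OF assms(3)]
    by (auto intro: near_set_trans)
qed

section \<open>Coarse centers of triples and the fourth point\<close>

text \<open>A variant of \<open>centers\<close> using unoriented lines and \<open>near_set\<close>,
  so that it is symmetric in the vertices.\<close>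

definition coarse_centers where
  "coarse_centers r a b c = {x \<in> mspace X. \<exists>\<Gamma>\<^sub>1 \<Gamma>\<^sub>2 \<Gamma>\<^sub>3. line a b \<Gamma>\<^sub>1 \<and> line b c \<Gamma>\<^sub>2 \<and> line c a \<Gamma>\<^sub>3 \<and>
     near_set X r \<Gamma>\<^sub>1 x \<and> near_set X r \<Gamma>\<^sub>2 x \<and> near_set X r \<Gamma>\<^sub>3 x}"

text \<open>Twice the distance to a common corner. The summand \<open>2 * k\<close> allows for two
  centers being defined by different lines with the same ends.\<close>

definition center_bound :: "real \<Rightarrow> real" where
  "center_bound r = 2 * (3 * (r + 2 * k + D) + k)"

text \<open>Each line is covered by two legs, and no leg serves all three lines, so \<open>x\<close>
  is near two distinct legs. The corner \<open>q\<close> is chosen before \<open>x\<close> and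
  \<open>r\<close>, hence serves for all centers at once.\<close>

lemma near_center:
  assumes "line a b \<Gamma>\<^sub>1" "line b c \<Gamma>\<^sub>2" "line c a \<Gamma>\<^sub>3"
  obtains q where "q \<in> mspace X" "\<And>x r. x \<in> mspace X \<Longrightarrow>
     near_set X r \<Gamma>\<^sub>1 x \<Longrightarrow> near_set X r \<Gamma>\<^sub>2 x \<Longrightarrow> near_set X r \<Gamma>\<^sub>3 x \<Longrightarrow> mdist X x q \<le> 3 * (r + D) + k"
proof (rule triangle_legs[OF assms], goal_cases)
  case (1 q A B C)
  \<comment> \<open>The first of these facts is the premise coming from \<open>obtains\<close>, so
    the properties of the legs start at \<open>legs(2)\<close>.\<close>
  note legs = 1
  show thesis
  proof (rule that)
    fix x r assume x: "x \<in> mspace X" "near_set X r \<Gamma>\<^sub>1 x" "near_set X r \<Gamma>\<^sub>2 x" "near_set X r \<Gamma>\<^sub>3 x"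
    have "near_set X r (A \<union> B) x" "near_set X r (B \<union> C) x" "near_set X r (C \<union> A) x"
      using near_set_mono[OF x(2) order_refl legs(2)] near_set_mono[OF x(3) order_refl legs(3)]
        near_set_mono[OF x(4) order_refl legs(4)] by auto
    thus "mdist X x q \<le> 3 * (r + D) + k"
      unfolding near_set_Un using legs(12-14)[OF x(1), of r] by blast
  qed (rule legs(5))
qed

lemma coarse_centers_dist:
  assumes "x \<in> coarse_centers r a b c" "y \<in> coarse_centers r a b c"
  shows "mdist X x y \<le> center_bound r"
proof -
  obtain \<Gamma>\<^sub>1 \<Gamma>\<^sub>2 \<Gamma>\<^sub>3 where x: "x \<in> mspace X" "line a b \<Gamma>\<^sub>1" "line b c \<Gamma>\<^sub>2" "line c a \<Gamma>\<^sub>3"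
      "near_set X r \<Gamma>\<^sub>1 x" "near_set X r \<Gamma>\<^sub>2 x" "near_set X r \<Gamma>\<^sub>3 x"
    using assms(1) unfolding coarse_centers_def by blast
  obtain \<Gamma>\<^sub>1' \<Gamma>\<^sub>2' \<Gamma>\<^sub>3' where y: "y \<in> mspace X" "line a b \<Gamma>\<^sub>1'" "line b c \<Gamma>\<^sub>2'" "line c a \<Gamma>\<^sub>3'"
      "near_set X r \<Gamma>\<^sub>1' y" "near_set X r \<Gamma>\<^sub>2' y" "near_set X r \<Gamma>\<^sub>3' y"
    using assms(2) unfolding coarse_centers_def by blast
  obtain q where q: "q \<in> mspace X" "\<And>x r. x \<in> mspace X \<Longrightarrow> near_set X r \<Gamma>\<^sub>1 x \<Longrightarrow>
      near_set X r \<Gamma>\<^sub>2 x \<Longrightarrow> near_set X r \<Gamma>\<^sub>3 x \<Longrightarrow> mdist X x q \<le> 3 * (r + D) + k"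
    using near_center[OF x(2-4)] by blast
  have "mdist X x q \<le> 3 * (r + D) + k" by (intro q x)
  \<comment> \<open>The corner belongs to the lines of \<open>x\<close>; \<open>near_lines\<close>
    exchanges those of \<open>y\<close> for them.\<close>
  moreover have "mdist X y q \<le> 3 * (r + 2 * k + D) + k"
    using x y by (intro q) (auto intro: near_lines)
  ultimately show ?thesis
    using mdist_triangle[of x X q y] x y q k_pos unfolding center_bound_def
    by (simp add: mdist_commute)
qed

lemma coarse_centers_permute:
  "coarse_centers r a c b = coarse_centers r a b c" "coarse_centers r b a c = coarse_centers r a b c"
  "coarse_centers r b c a = coarse_centers r a b c"
proof -
  have swap: "coarse_centers r a c b \<subseteq> coarse_centers r a b c" for a b c
    unfolding coarse_centers_def using line_sym by blast
  have rotate: "coarse_centers r b c a \<subseteq> coarse_centers r a b c" for a b c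
    unfolding coarse_centers_def by blast
  \<comment> \<open>Three rotations are the identity, so two more give the reverse
    inclusion.\<close>
  have rotate_eq: "coarse_centers r b c a = coarse_centers r a b c" for a b c
    by (intro subset_antisym rotate subset_trans[OF rotate rotate])
  have swap_eq: "coarse_centers r a c b = coarse_centers r a b c" for a b c
    by (rule subset_antisym[OF swap swap])
  show "coarse_centers r a c b = coarse_centers r a b c" by (rule swap_eq)
  show "coarse_centers r b c a = coarse_centers r a b c" by (rule rotate_eq)
  have "coarse_centers r b a c = coarse_centers r a c b" by (rule rotate_eq[symmetric])
  thus "coarse_centers r b a c = coarse_centers r a b c" by (simp only: swap_eq)
qed

lemma coarse_centers_mono: "r \<le> s \<Longrightarrow> coarse_centers r a b c \<subseteq> coarse_centers s a b c"
proof -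
  assume "r \<le> s"
  hence "near_set X s \<Gamma> x" if "near_set X r \<Gamma> x" for \<Gamma> x
    using near_set_mono[OF that _ subset_refl] by simp
  thus ?thesis unfolding coarse_centers_def by fast
qed

text \<open>Slimness of the three triangles with vertex \<open>d\<close> shows that \<open>x\<close> is near at least two of the
  three lines to \<open>d\<close>.\<close>

lemma coarse_centers_fourth_point:
  assumes "x \<in> coarse_centers r a b c" and ad: "line a d \<Gamma>\<^sub>a" and bd: "line b d \<Gamma>\<^sub>b" and cd: "line c d \<Gamma>\<^sub>c"
  shows "x \<in> coarse_centers (r + D) a b d \<or> x \<in> coarse_centers (r + D) b c d \<or>
    x \<in> coarse_centers (r + D) c a d"
proof -
  obtain \<Gamma>\<^sub>1 \<Gamma>\<^sub>2 \<Gamma>\<^sub>3 where x: "x \<in> mspace X" "line a b \<Gamma>\<^sub>1" "line b c \<Gamma>\<^sub>2" "line c a \<Gamma>\<^sub>3"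
      "near_set X r \<Gamma>\<^sub>1 x" "near_set X r \<Gamma>\<^sub>2 x" "near_set X r \<Gamma>\<^sub>3 x"
    using assms(1) unfolding coarse_centers_def by blast
  have "near_set X (r + D) \<Gamma>\<^sub>b x \<or> near_set X (r + D) \<Gamma>\<^sub>a x"
    "near_set X (r + D) \<Gamma>\<^sub>c x \<or> near_set X (r + D) \<Gamma>\<^sub>b x"
    "near_set X (r + D) \<Gamma>\<^sub>a x \<or> near_set X (r + D) \<Gamma>\<^sub>c x"
    using triangle_slim[OF x(2) bd line_sym[OF ad] x(5,1)]
      triangle_slim[OF x(3) cd line_sym[OF bd] x(6,1)]
      triangle_slim[OF x(4) ad line_sym[OF cd] x(7,1)] by auto
  moreover have "near_set X (r + D) \<Gamma>\<^sub>1 x" "near_set X (r + D) \<Gamma>\<^sub>2 x" "near_set X (r + D) \<Gamma>\<^sub>3 x"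
    using x D_pos by (auto intro: near_set_mono)
  ultimately show ?thesis
    unfolding coarse_centers_def using x(1-4) ad bd cd line_sym by blast
qed

section \<open>Bounding the cross-ratios\<close>

text \<open>Two steps through a center shared by two triples. In the radius, \<open>k\<close> comes
  from \<open>centers\<close>, 1 from replacing \<open>nbhd\<close> by \<open>near_set\<close>, and
  \<open>D\<close> from passing to the fourth point.\<close>

definition cross_bound :: real where
  "cross_bound = 2 * center_bound (k + 1 + D)"

lemma coarse_centers_common_dist:
  assumes "x \<in> coarse_centers (k + 1 + D) a b c" "x \<in> coarse_centers (k + 1 + D) a' b' c'"
    and "y \<in> coarse_centers (k + 1) a b c" "z \<in> coarse_centers (k + 1) a' b' c'"
  shows "mdist X y z \<le> cross_bound"
proof -
  have "y \<in> coarse_centers (k + 1 + D) a b c" "z \<in> coarse_centers (k + 1 + D) a' b' c'"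
    using assms(3,4) coarse_centers_mono[of "k + 1" "k + 1 + D"] D_pos by auto
  hence "mdist X y x \<le> center_bound (k + 1 + D)" "mdist X x z \<le> center_bound (k + 1 + D)"
    using assms(1,2) coarse_centers_dist by auto
  moreover have "mdist X y z \<le> mdist X y x + mdist X x z"
    using assms by (intro mdist_triangle) (auto simp: coarse_centers_def)
  ultimately show ?thesis unfolding cross_bound_def by simp
qed

text \<open>The condition in \<open>boundary_tuples\<close> for a set of points, so that reordering
  and passing to subtuples are immediate.\<close>

definition all_morse where
  "all_morse V \<longleftrightarrow> V \<subseteq> \<partial> \<and> (\<forall>a\<in>V. \<forall>b\<in>V. a \<noteq> b \<longrightarrow>
     (\<forall>I \<gamma>. geodesic_joining X (Ideal a) (Ideal b) I \<gamma> \<longrightarrow> morse_geodesic X N I \<gamma>))"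

lemma all_morse_mono: "all_morse W \<Longrightarrow> V \<subseteq> W \<Longrightarrow> all_morse V"
  unfolding all_morse_def by (meson subset_iff)

lemma all_morse_line:
  assumes "all_morse V" "a \<in> V" "b \<in> V" "a \<noteq> b" "geodesic_joining X (Ideal a) (Ideal b) UNIV \<gamma>"
  shows "line a b (range \<gamma>)"
  unfolding line_def
proof (intro conjI exI[of _ \<gamma>] refl)
  show "a \<in> \<partial>" "b \<in> \<partial>" using assms(1-3) unfolding all_morse_def by auto
  show "morse_geodesic X N UNIV \<gamma>"
    using assms(1)[unfolded all_morse_def, THEN conjunct2, rule_format, OF assms(2-5)] .
qed (rule assms(5))

text \<open>Sides between ideal vertices are parametrized by all reals and are Morse by assumption,
  hence give lines.\<close>

lemma centers_subset:
  assumes "all_morse {a, b, c}" "distinct [a, b, c]"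
  shows "centers X k a b c \<subseteq> coarse_centers (k + 1) a b c"
proof
  fix x assume "x \<in> centers X k a b c"
  then obtain I\<^sub>1 \<gamma>\<^sub>1 I\<^sub>2 \<gamma>\<^sub>2 I\<^sub>3 \<gamma>\<^sub>3 where
      tri: "geodesic_triangle X (Ideal a) (Ideal b) (Ideal c) I\<^sub>1 \<gamma>\<^sub>1 I\<^sub>2 \<gamma>\<^sub>2 I\<^sub>3 \<gamma>\<^sub>3" and
      x: "x \<in> nbhd X k (\<gamma>\<^sub>1 ` I\<^sub>1)" "x \<in> nbhd X k (\<gamma>\<^sub>2 ` I\<^sub>2)" "x \<in> nbhd X k (\<gamma>\<^sub>3 ` I\<^sub>3)"
    unfolding centers_def by blast
  have I: "I\<^sub>1 = UNIV" "I\<^sub>2 = UNIV" "I\<^sub>3 = UNIV"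
    using tri unfolding geodesic_triangle_def by auto
  have "line a b (range \<gamma>\<^sub>1)" "line b c (range \<gamma>\<^sub>2)" "line c a (range \<gamma>\<^sub>3)"
    using tri assms(2) unfolding geodesic_triangle_def I
    by (auto intro!: all_morse_line[OF assms(1)] simp del: geodesic_joining.simps)
  moreover have "near_set X (k + 1) (range \<gamma>\<^sub>1) x" "near_set X (k + 1) (range \<gamma>\<^sub>2) x"
      "near_set X (k + 1) (range \<gamma>\<^sub>3) x"
    using x k_pos unfolding I by (auto intro: near_set_of_nbhd)
  ultimately show "x \<in> coarse_centers (k + 1) a b c"
    using x(1) unfolding coarse_centers_def nbhd_def by blast
qed

text \<open>Two centers of one triple are always close, one of them serving as the shared center.
  Only mixed pairs remain, and there are none if one of the triples has no centers.\<close>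

lemma cross_ratio_le:
  assumes "all_morse {a, b, c, d}" "distinct [a, b, c, d]"
    and "\<And>y z. y \<in> coarse_centers (k + 1) a b c \<Longrightarrow> z \<in> coarse_centers (k + 1) a d c \<Longrightarrow>
      mdist X y z \<le> cross_bound"
  shows "cross_ratio X k a b c d \<le> ennreal cross_bound"
proof -
  have sub: "centers X k a b c \<subseteq> coarse_centers (k + 1) a b c"
      "centers X k a d c \<subseteq> coarse_centers (k + 1) a d c"
    by (rule centers_subset[OF all_morse_mono[OF assms(1)]]; use assms(2) in auto)+
  have same: "mdist X y z \<le> cross_bound"
    if "y \<in> coarse_centers (k + 1) a' b' c'" "z \<in> coarse_centers (k + 1) a' b' c'" for y z a' b' c'
  proof -
    have "y \<in> coarse_centers (k + 1 + D) a' b' c'"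
      using that(1) coarse_centers_mono[of "k + 1" "k + 1 + D"] D_pos by auto
    thus ?thesis using that by (intro coarse_centers_common_dist)
  qed
  have "mdist X y z \<le> cross_bound"
    if "y \<in> centers X k a b c \<union> centers X k a d c" "z \<in> centers X k a b c \<union> centers X k a d c" for y z
  proof -
    have "y \<in> coarse_centers (k + 1) a b c \<or> y \<in> coarse_centers (k + 1) a d c"
      "z \<in> coarse_centers (k + 1) a b c \<or> z \<in> coarse_centers (k + 1) a d c"
      using that sub by auto
    thus ?thesis
      using same[of y _ _ _ z] assms(3)[of y z] assms(3)[of z y] mdist_commute[of X y z] by auto
  qed
  thus ?thesis unfolding cross_ratio_def set_diam_def
    by (intro SUP_least ennreal_leI) auto
qed

lemma cross_ratios_bound:
  assumes "all_morse {a, b, c, d}" "distinct [a, b, c, d]"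
  shows "cross_ratio X k a b c d \<le> ennreal cross_bound \<or>
    cross_ratio X k a c b d \<le> ennreal cross_bound \<or> cross_ratio X k b a c d \<le> ennreal cross_bound"
proof (rule ccontr)
  let ?m = "coarse_centers (k + 1)" and ?m' = "coarse_centers (k + 1 + D)"
  have perm: "all_morse {a, c, b, d}" "all_morse {b, a, c, d}" "distinct [a, c, b, d]" "distinct [b, a, c, d]"
    using assms by (auto simp: insert_commute)
  assume neg: "\<not> ?thesis"
  obtain x z\<^sub>1 where 1: "x \<in> ?m a b c" "z\<^sub>1 \<in> ?m a d c" "\<not> mdist X x z\<^sub>1 \<le> cross_bound"
    using cross_ratio_le[OF assms] neg by blast
  obtain y\<^sub>2 z\<^sub>2 where 2: "y\<^sub>2 \<in> ?m a c b" "z\<^sub>2 \<in> ?m a d b" "\<not> mdist X y\<^sub>2 z\<^sub>2 \<le> cross_bound"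
    using cross_ratio_le[OF perm(1,3)] neg by blast
  obtain y\<^sub>3 z\<^sub>3 where 3: "y\<^sub>3 \<in> ?m b a c" "z\<^sub>3 \<in> ?m b d c" "\<not> mdist X y\<^sub>3 z\<^sub>3 \<le> cross_bound"
    using cross_ratio_le[OF perm(2,4)] neg by blast
  \<comment> \<open>The far apart pairs contain centers of \<open>a, d, c\<close> and of
    \<open>a, d, b\<close>, and these supply all three lines to \<open>d\<close>;
    \<open>all_morse\<close> alone does not assert that lines exist.\<close>
  obtain \<Gamma>\<^sub>a \<Gamma>\<^sub>b \<Gamma>\<^sub>c where "line a d \<Gamma>\<^sub>a" "line b d \<Gamma>\<^sub>b" "line c d \<Gamma>\<^sub>c"
    using 1(2) 2(2) line_sym unfolding coarse_centers_def by blast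
  hence "x \<in> ?m' a b d \<or> x \<in> ?m' b c d \<or> x \<in> ?m' c a d"
    using coarse_centers_fourth_point[OF 1(1)] by blast
  moreover have "x \<in> ?m' a b c"
    using 1(1) coarse_centers_mono[of "k + 1" "k + 1 + D"] D_pos by auto
  \<comment> \<open>Up to order, the three cross-ratios compare the triple \<open>a, b, c\<close>
    with \<open>c, a, d\<close>, with \<open>a, b, d\<close> and with \<open>b, c, d\<close>:
    whichever of them shares the center \<open>x\<close> contradicts the corresponding far apart
    pair.\<close>
  moreover have "y\<^sub>2 \<in> ?m a b c" "z\<^sub>2 \<in> ?m a b d" "y\<^sub>3 \<in> ?m a b c" "z\<^sub>3 \<in> ?m b c d" "z\<^sub>1 \<in> ?m c a d"
    using 1(2) 2(1,2) 3(1,2)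
    by (simp_all only: coarse_centers_permute(1)[of _ a c b] coarse_centers_permute(1)[of _ a d b]
        coarse_centers_permute(2)[of _ b a c] coarse_centers_permute(1)[of _ b d c]
        coarse_centers_permute(3)[of _ a d c])
  ultimately show False
    using 1(1,3) 2(3) 3(3) coarse_centers_common_dist by blast
qed

end

theorem proposition5p5:
  fixes X :: "'a metric" and p :: 'a
    and K :: "(real \<Rightarrow> real \<Rightarrow> real) \<Rightarrow> real"
    and \<SS> :: "'i set" and CC :: "'i \<Rightarrow> 'c metric" and \<pi> :: "'i \<Rightarrow> 'a \<Rightarrow> 'c set"
    and nest orth :: "'i \<Rightarrow> 'i \<Rightarrow> bool"
    and \<rho> :: "'i \<Rightarrow> 'i \<Rightarrow> 'c set" and \<rho>\<^sub>m :: "'i \<Rightarrow> 'i \<Rightarrow> 'c \<Rightarrow> 'c set" and S :: 'i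
  assumes "proper_metric X" and "geodesic_space X" and "p \<in> mspace X"
    and "hhs_data.maximal_almost_hhs X \<SS> CC \<pi> nest orth \<rho> \<rho>\<^sub>m S"
    and "\<forall>N. morse_gauge N \<longrightarrow> center_constant X p N (K N)"
  shows "\<forall>N. morse_gauge N \<longrightarrow>
    (\<exists>C::real. \<forall>a b c d. [a, b, c, d] \<in> boundary_tuples X p 4 N \<longrightarrow>
       cross_ratio X (K N) a b c d < ennreal C \<or>
       cross_ratio X (K N) a c b d < ennreal C \<or>
       cross_ratio X (K N) b a c d < ennreal C)"
proof (intro allI impI)
  fix N assume "morse_gauge N"
  then interpret morse_triangles X p N "K N"
    using assms by unfold_locales auto
  \<comment> \<open>As \<open>ennreal\<close> sends negative reals to 0, the sign ensures that
    adding 1 gives the strict inequality.\<close>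
  have "0 \<le> cross_bound"
    using k_pos D_pos unfolding cross_bound_def center_bound_def by simp
  hence lt: "ennreal cross_bound < ennreal (cross_bound + 1)" by (simp add: ennreal_less_iff)
  show "\<exists>C::real. \<forall>a b c d. [a, b, c, d] \<in> boundary_tuples X p 4 N \<longrightarrow>
       cross_ratio X (K N) a b c d < ennreal C \<or>
       cross_ratio X (K N) a c b d < ennreal C \<or>
       cross_ratio X (K N) b a c d < ennreal C"
  proof (intro exI[of _ "cross_bound + 1"] allI impI)
    fix a b c d assume "[a, b, c, d] \<in> boundary_tuples X p 4 N"
    hence "all_morse {a, b, c, d}" "distinct [a, b, c, d]"
      unfolding boundary_tuples_def all_morse_def by auto
    thus "cross_ratio X (K N) a b c d < ennreal (cross_bound + 1) \<or>
       cross_ratio X (K N) a c b d < ennreal (cross_bound + 1) \<or>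
       cross_ratio X (K N) b a c d < ennreal (cross_bound + 1)"
      using cross_ratios_bound lt le_less_trans by blast
  qed
qed

end
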